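(* For $t>0$ and $\epsilon\in[0,1]$ let $$|\psi_t\rangle=\frac{|0\rangle+t|3\rangle}{\sqrt{1+t^2}},\qquad \tau=\frac23\sum_{j=0}^\infty3^{-j}|j\rangle\langle j|,\qquad \rho_{t,\epsilon}=(1-\epsilon)|\psi_t\rangle\langle\psi_t|+\epsilon\tau,$$ and let $\epsilon_*(t)$ be the least $\epsilon\in[0,1]$ for which $W_{\rho_{t,\epsilon}}\ge0$ everywhere on $\mathbb R^2$. For all sufficiently small $t>0$, define $$M(t)=\sup_{x\ge0}\frac{2e^{-x/2}}{1+t^2}\left[-1-t^2F(x)+\frac{4t}{\sqrt3}x^{3/2}\right]_+,\qquad F(x)=-1+6x-6x^2+\frac43x^3,$$ where $[u]_+=\max\{u,0\}$. Then $$\epsilon_*(t)=\frac{M(t)}{1+M(t)},\qquad \lim_{t\downarrow0}t^{2/3}\ln\epsilon_*(t)=-\frac12\left(\frac34\right)^{1/3}.$$ At $\epsilon=\epsilon_*(t)$ the Wigner function $W_{\rho_{t,\epsilon}}$ has a zero, and it is strictly positive everywhere for $\epsilon\in(\epsilon_*(t),1]$.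
   Context: One bosonic mode on $L^2(\mathbb R)$ with $[\hat q,\hat p]=i$, $\hat a=(\hat q+i\hat p)/\sqrt2$; $|n\rangle$ are the Fock (number) states, $|n\rangle=(\hat a^\dagger)^n|0\rangle/\sqrt{n!}$ with $\hat a|0\rangle=0$. The Wigner function of a density operator is $W_\rho(q,p)=\frac1\pi\int_{\mathbb R}e^{2ipy}\langle q-y|\rho|q+y\rangle\,dy$. (The thermal state $\tau$ has $W_\tau(q,p)=\frac1{2\pi}e^{-(q^2+p^2)/2}$.) *)

theory Defs
  imports "HOL-Probability.Probability" "HOL-Library.Complex_Order"
begin

text \<open>
  Vectors of the Hilbert space of square-integrable functions on the line are represented by
  functions, with equality in that space read as equality almost everywhere; operators are maps
  between such functions.
\<close>

type_synonym wavefun = "real \<Rightarrow> complex"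
type_synonym qoperator = "wavefun \<Rightarrow> wavefun"

definition square_integrable :: "wavefun \<Rightarrow> bool" where
  "square_integrable f \<longleftrightarrow>
     f \<in> borel_measurable lborel \<and> integrable lborel (\<lambda>x. (cmod (f x))\<^sup>2)"

definition braket :: "wavefun \<Rightarrow> wavefun \<Rightarrow> complex" where
  "braket f g = (LINT x|lborel. cnj (f x) * g x)"

definition ketbra :: "wavefun \<Rightarrow> wavefun \<Rightarrow> qoperator" where
  "ketbra f g = (\<lambda>h x. f x * braket g h)"

definition position_op :: qoperator where
  "position_op f = (\<lambda>x. of_real x * f x)"

definition momentum_op :: qoperator where
  "momentum_op f = (\<lambda>x. - \<i> * vector_derivative f (at x))"

definition annihilation_op :: qoperator where
  "annihilation_op f = (\<lambda>x. (position_op f x + \<i> * momentum_op f x) / of_real (sqrt 2))"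

definition creation_op :: qoperator where
  "creation_op f = (\<lambda>x. (position_op f x - \<i> * momentum_op f x) / of_real (sqrt 2))"

text \<open>
  The kernel of the annihilation operator is one-dimensional, so the normalised vacuum is fixed up
  to a phase, which no projector depends on. It is chosen positive here.
\<close>

definition vacuum :: wavefun where
  "vacuum = (\<lambda>x. of_real (pi powr (- 1 / 4) * exp (- x\<^sup>2 / 2)))"

definition fock :: "nat \<Rightarrow> wavefun" where
  "fock n = (\<lambda>x. (creation_op ^^ n) vacuum x / of_real (sqrt (fact n)))"

text \<open>
  The matrix elements \<open>\<langle>x|\<rho>|y\<rangle>\<close> of an operator are its integral kernel in the position
  representation. The operator fixes the kernel only up to null sets; the continuous version, unique
  by \<open>is_position_kernel_unique\<close> below, gives the pointwise values that the Wigner function needs.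
\<close>

definition is_position_kernel :: "qoperator \<Rightarrow> (real \<Rightarrow> real \<Rightarrow> complex) \<Rightarrow> bool" where
  "is_position_kernel \<rho> k \<longleftrightarrow>
     continuous_on UNIV (\<lambda>(x, y). k x y) \<and>
     (\<forall>f. square_integrable f \<longrightarrow>
        (AE x in lborel. integrable lborel (\<lambda>y. k x y * f y) \<and>
                         \<rho> f x = (LINT y|lborel. k x y * f y)))"

definition position_kernel :: "qoperator \<Rightarrow> real \<Rightarrow> real \<Rightarrow> complex" where
  "position_kernel \<rho> = (THE k. is_position_kernel \<rho> k)"

text \<open>
  The Wigner function takes complex values a priori. In the order on the complex numbers, \<open>0 \<le> z\<close>
  and \<open>0 < z\<close> include that \<open>z\<close> is real.
\<close>

definition wigner :: "qoperator \<Rightarrow> real \<Rightarrow> real \<Rightarrow> complex" where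
  "wigner \<rho> q p = 1 / of_real pi *
     (LINT y|lborel. exp (2 * \<i> * of_real p * of_real y) * position_kernel \<rho> (q - y) (q + y))"

definition psi_state :: "real \<Rightarrow> wavefun" where
  "psi_state t = (\<lambda>x. (fock 0 x + of_real t * fock 3 x) / of_real (sqrt (1 + t\<^sup>2)))"

definition thermal_state :: qoperator where
  "thermal_state = (\<lambda>f x. 2 / 3 * (\<Sum>j. (1 / 3) ^ j * ketbra (fock j) (fock j) f x))"

definition rho_state :: "real \<Rightarrow> real \<Rightarrow> qoperator" where
  "rho_state t \<epsilon> = (\<lambda>f x. of_real (1 - \<epsilon>) * ketbra (psi_state t) (psi_state t) f x
                            + of_real \<epsilon> * thermal_state f x)"

definition wigner_nonneg_at :: "real \<Rightarrow> real \<Rightarrow> bool" where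
  "wigner_nonneg_at t \<epsilon> \<longleftrightarrow> 0 \<le> \<epsilon> \<and> \<epsilon> \<le> 1 \<and> (\<forall>q p. 0 \<le> wigner (rho_state t \<epsilon>) q p)"

definition eps_star :: "real \<Rightarrow> real" where
  "eps_star t = (LEAST \<epsilon>. wigner_nonneg_at t \<epsilon>)"

definition F_poly :: "real \<Rightarrow> real" where
  "F_poly x = - 1 + 6 * x - 6 * x\<^sup>2 + 4 / 3 * x ^ 3"

definition M_fun :: "real \<Rightarrow> real \<Rightarrow> real" where
  "M_fun t x = 2 * exp (- x / 2) / (1 + t\<^sup>2) *
     max (- 1 - t\<^sup>2 * F_poly x + 4 * t / sqrt 3 * x powr (3 / 2)) 0"

definition M_sup :: "real \<Rightarrow> real" where
  "M_sup t = (SUP x\<in>{0..}. M_fun t x)"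

lemma has_vector_derivative_vacuum:
  "(vacuum has_vector_derivative of_real (- x) * vacuum x) (at x)"
proof -
  have "((\<lambda>x::real. pi powr (- 1 / 4) * exp (- x\<^sup>2 / 2)) has_real_derivative
          - x * (pi powr (- 1 / 4) * exp (- x\<^sup>2 / 2))) (at x)"
    by (auto intro!: derivative_eq_intros)
  from has_vector_derivative_of_real[OF this] show ?thesis
    by (simp add: vacuum_def)
qed

lemma annihilation_op_vacuum: "annihilation_op vacuum = (\<lambda>x. 0)"
  using vector_derivative_at[OF has_vector_derivative_vacuum]
  by (simp add: fun_eq_iff annihilation_op_def position_op_def momentum_op_def)

lemma braket_vacuum: "braket vacuum vacuum = 1"
proof -
  have "cnj (vacuum x) * vacuum x = of_real (normal_density 0 (1 / sqrt 2) x)" for x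
  proof -
    have 1: "pi powr (- 1 / 4) * pi powr (- 1 / 4) = 1 / sqrt pi"
      by (simp add: powr_add[symmetric] powr_minus_divide powr_half_sqrt)
    have 2: "exp (- x\<^sup>2 / 2) * exp (- x\<^sup>2 / 2) = exp (- x\<^sup>2)"
      by (simp add: exp_add[symmetric])
    have "pi powr (- 1 / 4) * exp (- x\<^sup>2 / 2) * (pi powr (- 1 / 4) * exp (- x\<^sup>2 / 2))
            = 1 / sqrt pi * exp (- x\<^sup>2)"
      unfolding 1[symmetric] 2[symmetric] by (simp only: mult_ac)
    also have "\<dots> = normal_density 0 (1 / sqrt 2) x"
      by (simp add: normal_density_def power_divide)
    finally show ?thesis
      unfolding vacuum_def complex_cnj_complex_of_real of_real_mult[symmetric] by simp
  qed
  then show ?thesis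
    unfolding braket_def by (simp add: integral_normal_density)
qed

lemma is_position_kernel_unique:
  assumes "is_position_kernel \<rho> k" and "is_position_kernel \<rho> k'"
  shows "k = k'"
proof (rule ccontr)
  assume "k \<noteq> k'"
  then obtain x0 y0 where ne: "k x0 y0 \<noteq> k' x0 y0" by (auto simp: fun_eq_iff)
  define d where "d = (\<lambda>x y. cnj (k x0 y0 - k' x0 y0) * (k x y - k' x y))"
  have cont: "continuous_on UNIV (\<lambda>(x, y). d x y)"
    using assms unfolding is_position_kernel_def d_def case_prod_unfold
    by (auto intro!: continuous_intros)
  have "open ((\<lambda>(x, y). Re (d x y)) -` {0<..})"
    using cont by (intro open_vimage) (auto intro!: continuous_intros simp: case_prod_unfold)
  have pos0: "0 < Re (cnj z * z)" if "z \<noteq> 0" for z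
  proof -
    have "cnj z * z = of_real ((cmod z)\<^sup>2)"
      using complex_norm_square[of z] by (simp add: mult.commute)
    then show ?thesis using that by simp
  qed
  have "0 < Re (d x0 y0)"
    using pos0[of "k x0 y0 - k' x0 y0"] ne unfolding d_def by (metis right_minus_eq)
  then have "(x0, y0) \<in> (\<lambda>(x, y). Re (d x y)) -` {0<..}" by simp
  with \<open>open ((\<lambda>(x, y). Re (d x y)) -` {0<..})\<close> obtain A B where AB: "open A" "open B" "x0 \<in> A" "y0 \<in> B"
      "A \<times> B \<subseteq> (\<lambda>(x, y). Re (d x y)) -` {0<..}"
    by (elim open_prod_elim) auto
  then have pos: "0 < Re (d x y)" if "x \<in> A" "y \<in> B" for x y using that by fastforce
  obtain r where r: "r > 0" "cball y0 r \<subseteq> B"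
    using AB open_contains_cball by blast
  define f :: wavefun where "f = indicator {y0 - r..y0 + r}"
  have "cmod (f x) ^ 2 = indicator {y0 - r..y0 + r} x" for x
    by (simp add: f_def indicator_def)
  then have "square_integrable f"
    by (simp add: square_integrable_def f_def integrable_indicator_iff emeasure_lborel_Icc_eq)
  then have ae: "AE x in lborel. integrable lborel (\<lambda>y. k x y * f y) \<and>
                      integrable lborel (\<lambda>y. k' x y * f y) \<and>
                      (LINT y|lborel. k x y * f y) = (LINT y|lborel. k' x y * f y)"
    using assms unfolding is_position_kernel_def by fastforce
  have contra: "False" if "x \<in> A" "integrable lborel (\<lambda>y. k x y * f y)"
      "integrable lborel (\<lambda>y. k' x y * f y)"
      "(LINT y|lborel. k x y * f y) = (LINT y|lborel. k' x y * f y)" for x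
  proof -
    have d: "d x y * f y = cnj (k x0 y0 - k' x0 y0) * (k x y * f y - k' x y * f y)" for y
      by (simp add: d_def algebra_simps)
    have int: "integrable lborel (\<lambda>y. d x y * f y)"
      unfolding d using that by (intro integrable_mult_right Bochner_Integration.integrable_diff)
    have "(LINT y|lborel. d x y * f y) = 0"
      unfolding d using that by simp
    then have zero: "(LINT y|lborel. Re (d x y * f y)) = 0"
      by (simp only: integral_Re[OF int] zero_complex.sel)
    have nn: "0 \<le> Re (d x y * f y)" for y
      using pos[OF \<open>x \<in> A\<close>, of y] r by (auto simp: f_def indicator_def dist_real_def subset_iff)
    have "AE y in lborel. Re (d x y * f y) = 0"
      using integral_nonneg_eq_0_iff_AE[OF integrable_Re[OF int]] nn zero by simp
    then have "AE y in lborel. y \<notin> {y0 - r..y0 + r}"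
    proof eventually_elim
      case (elim y)
      then show ?case
        using pos[OF \<open>x \<in> A\<close>, of y] r by (auto simp: f_def indicator_def dist_real_def subset_iff)
    qed
    then have "emeasure lborel {y0 - r..y0 + r} = 0"
      by (subst (asm) AE_iff_measurable[OF _ refl])
      (auto simp: atLeastAtMost_def atLeast_def atMost_def Int_def)
    then show False using r by simp
  qed
  have "AE x in lborel. x \<notin> A"
    using ae by (rule eventually_mono) (use contra in blast)
  obtain s where s: "s > 0" "cball x0 s \<subseteq> A"
    using AB open_contains_cball by blast
  have "AE x in lborel. x \<notin> {x0 - s..x0 + s}"
    using \<open>AE x in lborel. x \<notin> A\<close> s
    by (auto elim!: eventually_mono simp: dist_real_def subset_iff)
  then have "emeasure lborel {x0 - s..x0 + s} = 0"
    by (subst (asm) AE_iff_measurable[OF _ refl])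
      (auto simp: atLeastAtMost_def atLeast_def atMost_def Int_def)
  then show False using s by simp
qed

lemma position_kernel_eqI: "is_position_kernel \<rho> k \<Longrightarrow> position_kernel \<rho> = k"
  unfolding position_kernel_def using is_position_kernel_unique by blast

end

(*
The Wigner function is explicit. Writing x = q^2 + p^2, a superposition of |0> and |3> gives a
Gaussian times 1 + t^2 F(x) + (4t/sqrt 3) Re (q + ip)^3; its kernel is a polynomial times a Gaussian,
so only even Gaussian moments are needed. Mehler's formula at r = 1/3 turns the thermal mixture into a
Gaussian kernel. Mehler's formula itself follows from a linear differential equation in r for the
generating function of the products of Hermite values.

Minimising over the angle replaces Re (q + ip)^3 by -x^(3/2), which reduces positivity to
(1 - eps) M(t) <= eps. For the asymptotics, complete the square: the bracket in M equals
t^2 (1 - 6x + 6x^2) - (1 - 2t x^(3/2)/sqrt 3)^2. It is positive at x_0 = (3/4)^(1/3) t^(-2/3), where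
the square vanishes, and can only be positive for x >= x_0 - O(t x_0^2) = x_0 - o(x_0), so that
ln M(t) ~ -x_0/2.
*)

theory Submission
  imports Defs "HOL-Real_Asymp.Real_Asymp"
begin

section \<open>Hermite functions and Mehler's formula\<close>

text \<open>\<open>hermite n x\<close> is the probabilists' polynomial He_n at sqrt 2 * x, the
  scaling in which \<open>creation_op\<close> raises the index without a scalar factor. The analytic
  obstacle is that the thermal state is an operator series, evaluated one wavefunction at a time: it
  has an integral kernel only once the sum has been exchanged with an integral against an arbitrary
  square-integrable function. Mehler's formula supplies the domination as well as the value, because
  on the diagonal its terms are nonnegative with a Gaussian sum, which also bounds every single Fock
  function. The formula for \<open>eps_star\<close> holds for every t > 0. Smallness of t enters
  through positivity of M, from which the zero at the threshold is obtained, and through the limit.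
  There, factors polynomial in t or 1 / t are harmless, since t^(2/3) * ln t tends to 0.\<close>

fun hermite :: "nat \<Rightarrow> real \<Rightarrow> real" where
  "hermite 0 x = 1"
| "hermite (Suc 0) x = sqrt 2 * x"
| "hermite (Suc (Suc n)) x = sqrt 2 * x * hermite (Suc n) x - real (Suc n) * hermite n x"

lemma hermite_Suc: "hermite (Suc n) x = sqrt 2 * x * hermite n x - real n * hermite (n - 1) x"
  by (cases n) auto

lemma has_real_derivative_hermite [derivative_intros]:
  "(hermite n has_real_derivative sqrt 2 * real n * hermite (n - 1) x) (at x)"
proof (induction n x rule: hermite.induct)
  case (1 x)
  have "hermite 0 = (\<lambda>x. 1)" by (simp add: fun_eq_iff)
  then show ?case by simp
next
  case (2 x)
  have "hermite (Suc 0) = (\<lambda>x. sqrt 2 * x)" by (simp add: fun_eq_iff)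
  then show ?case by (auto intro!: derivative_eq_intros)
next
  case (3 n x)
  have *: "hermite (Suc (Suc n)) = (\<lambda>x. sqrt 2 * x * hermite (Suc n) x - real (Suc n) * hermite n x)"
    by (simp add: fun_eq_iff)
  have "((\<lambda>x. sqrt 2 * x * hermite (Suc n) x - real (Suc n) * hermite n x) has_real_derivative
      sqrt 2 * hermite (Suc n) x + sqrt 2 * x * (sqrt 2 * real (Suc n) * hermite n x)
        - real (Suc n) * (sqrt 2 * real n * hermite (n - 1) x)) (at x)"
    using 3 by (auto intro!: derivative_eq_intros)
  also have "sqrt 2 * hermite (Suc n) x + sqrt 2 * x * (sqrt 2 * real (Suc n) * hermite n x)
        - real (Suc n) * (sqrt 2 * real n * hermite (n - 1) x)
     = sqrt 2 * hermite (Suc n) x + sqrt 2 * real (Suc n) * (sqrt 2 * x * hermite n x - real n * hermite (n - 1) x)"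
    by (simp add: algebra_simps)
  also have "\<dots> = sqrt 2 * real (Suc (Suc n)) * hermite (Suc n) x"
    unfolding hermite_Suc[symmetric] by (simp add: algebra_simps)
  finally show ?case
    by (simp add: *)
qed

lemma continuous_on_hermite [continuous_intros]: "continuous_on S (hermite n)"
  by (meson DERIV_isCont continuous_at_imp_continuous_on has_real_derivative_hermite)

section \<open>Fock states as explicit real functions\<close>

definition fock_real :: "nat \<Rightarrow> real \<Rightarrow> real" where
  "fock_real n x = pi powr (- 1 / 4) * hermite n x / sqrt (fact n) * exp (- x\<^sup>2 / 2)"

text \<open>Differentiating the Gaussian doubles the x term, so (x - d/dx) / sqrt 2 acts on the
  polynomial factor h as sqrt 2 * x * h - h' / sqrt 2. By the derivative rule this is exactly the
  recurrence \<open>hermite_Suc\<close>.\<close>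

lemma creation_op_power_vacuum:
  "(creation_op ^^ n) vacuum = (\<lambda>x. of_real (pi powr (- 1 / 4) * hermite n x * exp (- x\<^sup>2 / 2)))"
proof (induction n)
  case 0
  show ?case by (simp add: vacuum_def)
next
  case (Suc n)
  let ?c = "pi powr (- 1 / 4)"
  have "creation_op (\<lambda>x. of_real (?c * hermite n x * exp (- x\<^sup>2 / 2))) x
      = of_real (?c * hermite (Suc n) x * exp (- x\<^sup>2 / 2))" for x
  proof -
    let ?d = "?c * (sqrt 2 * real n * hermite (n - 1) x * exp (- x\<^sup>2 / 2)
               + hermite n x * (- x * exp (- x\<^sup>2 / 2)))"
    have "((\<lambda>x. ?c * hermite n x * exp (- x\<^sup>2 / 2)) has_real_derivative ?d) (at x)"
      by (auto intro!: derivative_eq_intros simp: algebra_simps)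
    from has_vector_derivative_of_real[OF this]
    have d: "vector_derivative (\<lambda>x. complex_of_real (?c * hermite n x * exp (- x\<^sup>2 / 2))) (at x) = of_real ?d"
      by (rule vector_derivative_at)
    have "x * (?c * hermite n x * exp (- x\<^sup>2 / 2)) - ?d
        = sqrt 2 * (?c * hermite (Suc n) x * exp (- x\<^sup>2 / 2))"
      unfolding hermite_Suc using real_sqrt_mult_self[of 2]
      by (simp add: algebra_simps)
    then have *: "(x * (?c * hermite n x * exp (- x\<^sup>2 / 2)) - ?d) / sqrt 2
        = ?c * hermite (Suc n) x * exp (- x\<^sup>2 / 2)"
      by simp
    show ?thesis
      unfolding creation_op_def momentum_op_def position_op_def d *[symmetric]
      by simp
  qed
  then show ?case
    by (simp add: Suc.IH fun_eq_iff)
qed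

lemma fock_eq: "fock n x = of_real (fock_real n x)"
  by (simp add: fock_def creation_op_power_vacuum fock_real_def)

lemma continuous_on_fock_real [continuous_intros]: "continuous_on S (fock_real n)"
  unfolding fock_real_def by (intro continuous_intros) auto

section \<open>Growth of Hermite values and the generating function of their products\<close>

lemma hermite_growth:
  fixes x :: real
  assumes "c > 1"
  shows "\<exists>K. \<forall>n. \<bar>hermite n x\<bar> \<le> K * c ^ n * sqrt (fact n)"
proof -
  \<comment> \<open>Beyond \<open>N\<close> the coefficient of p (n + 1) in \<open>rec\<close> is at
    most c - 1, and (c - 1) * c^(n+1) + c^(n+1) = c^(n+2) closes the induction.\<close>
  define N where "N = nat \<lceil>(sqrt 2 * \<bar>x\<bar> / (c - 1))\<^sup>2\<rceil>"
  have N: "sqrt 2 * \<bar>x\<bar> / sqrt (real (Suc n)) \<le> c - 1" if "n \<ge> N" for n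
  proof -
    have "(sqrt 2 * \<bar>x\<bar> / (c - 1))\<^sup>2 \<le> real (Suc n)"
      using that unfolding N_def by linarith
    then have "sqrt 2 * \<bar>x\<bar> / (c - 1) \<le> sqrt (real (Suc n))"
      by (rule real_le_rsqrt)
    then show ?thesis using assms by (simp add: field_simps)
  qed
  \<comment> \<open>This normalisation turns the coefficient n + 1 of the recurrence into sqrt ((n +
    1) / (n + 2)) \<le> 1, while the other coefficient decays like 1 / sqrt n, so growth is slower
    than any exponential.\<close>
  define p where "p = (\<lambda>n. \<bar>hermite n x\<bar> / sqrt (fact n))"
  have p0: "p n \<ge> 0" for n by (simp add: p_def)
  have rec: "p (Suc (Suc n)) \<le> sqrt 2 * \<bar>x\<bar> / sqrt (real (Suc (Suc n))) * p (Suc n) + p n" for n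
  proof -
    have "\<bar>hermite (Suc (Suc n)) x\<bar> \<le> sqrt 2 * \<bar>x\<bar> * \<bar>hermite (Suc n) x\<bar> + real (Suc n) * \<bar>hermite n x\<bar>"
      using abs_triangle_ineq4[of "sqrt 2 * x * hermite (Suc n) x" "real (Suc n) * hermite n x"]
      by (simp add: abs_mult)
    then have "p (Suc (Suc n)) \<le> (sqrt 2 * \<bar>x\<bar> * \<bar>hermite (Suc n) x\<bar> + real (Suc n) * \<bar>hermite n x\<bar>) / sqrt (fact (Suc (Suc n)))"
      unfolding p_def by (intro divide_right_mono) auto
    also have "\<dots> = sqrt 2 * \<bar>x\<bar> / sqrt (real (Suc (Suc n))) * p (Suc n) + 
          real (Suc n) * \<bar>hermite n x\<bar> / sqrt (fact (Suc (Suc n)))"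
      unfolding p_def fact_Suc[of "Suc n"] of_nat_mult by (simp add: real_sqrt_mult add_divide_distrib)
    also have "real (Suc n) * \<bar>hermite n x\<bar> / sqrt (fact (Suc (Suc n))) = 
        real (Suc n) / sqrt (real (Suc n) * real (Suc (Suc n))) * p n"
      unfolding p_def fact_Suc of_nat_mult by (simp add: real_sqrt_mult)
    also have "\<dots> \<le> 1 * p n"
    proof (intro mult_right_mono p0)
      have "real (Suc n) \<le> sqrt (real (Suc n) * real (Suc (Suc n)))"
        by (rule real_le_rsqrt) (simp add: power2_eq_square algebra_simps)
      then show "real (Suc n) / sqrt (real (Suc n) * real (Suc (Suc n))) \<le> 1"
        by (subst divide_le_eq_1) auto
    qed
    finally show ?thesis by simp
  qed
  define K where "K = Max (p ` {..Suc N})"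
  have K: "p n \<le> K" if "n \<le> Suc N" for n
    unfolding K_def using that by (intro Max_ge) auto
  have K0: "K \<ge> 0" using K[of 0] p0[of 0] by linarith
  have "p n \<le> K * c ^ n \<and> p (Suc n) \<le> K * c ^ Suc n" for n
  proof (induction n)
    case 0
    have "K \<le> K * c" using K0 assms by (simp add: mult_le_cancel_left1)
    then show ?case using K[of 0] K[of 1] by simp
  next
    case (Suc n)
    have "p (Suc (Suc n)) \<le> K * c ^ Suc (Suc n)"
    proof (cases "Suc (Suc n) \<le> Suc N")
      case True
      have "1 \<le> c ^ Suc (Suc n)" using assms by (intro one_le_power) auto
      then show ?thesis using K[OF True] mult_left_mono[OF _ K0, of 1 "c ^ Suc (Suc n)"] by simp
    next
      case False
      then have "sqrt 2 * \<bar>x\<bar> / sqrt (real (Suc (Suc n))) \<le> c - 1" by (intro N) auto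
      then have "sqrt 2 * \<bar>x\<bar> / sqrt (real (Suc (Suc n))) * p (Suc n) \<le> (c - 1) * p (Suc n)"
        by (intro mult_right_mono p0)
      also have "\<dots> \<le> (c - 1) * (K * c ^ Suc n)"
        using Suc assms by (intro mult_left_mono) auto
      finally have "p (Suc (Suc n)) \<le> (c - 1) * (K * c ^ Suc n) + p n"
        using rec[of n] by linarith
      also have "p n \<le> K * c ^ Suc n"
      proof -
        have "p n \<le> K * c ^ n" using Suc by simp
        also have "\<dots> \<le> K * c ^ Suc n"
          using K0 assms by (intro mult_left_mono power_increasing) auto
        finally show ?thesis .
      qed
      finally show ?thesis by (simp add: algebra_simps)
    qed
    then show ?case using Suc by simp
  qed
  then have "\<bar>hermite n x\<bar> \<le> K * c ^ n * sqrt (fact n)" for n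
    unfolding p_def by (auto simp: field_simps)
  then show ?thesis by blast
qed

text \<open>Each of the two Hermite factors costs c^n and the shift by k only a further factor n + 1
  and a constant; as c may be taken arbitrarily close to 1, the radius does not fall below 1. The
  shift k = 1 serves the series with neighbouring indices in \<open>mehler\<close>.\<close>

lemma fps_conv_radius_hermite:
  assumes "k \<le> 1"
  shows "fps_conv_radius (Abs_fps (\<lambda>n. hermite n x * hermite (n + k) y / fact n)) \<ge> 1"
  unfolding fps_conv_radius_def
proof (rule conv_radius_geI_ex')
  fix r :: real
  assume r: "0 < r" "ereal r < 1"
  then have r1: "r < 1" by simp
  obtain c where c: "c > 1" "c ^ 3 * r < 1"
  proof -
    have "((\<lambda>c. c ^ 3 * r) \<longlongrightarrow> 1 ^ 3 * r) (at_right 1)" by (intro tendsto_intros)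
    then have "\<forall>\<^sub>F c in at_right 1. c ^ 3 * r < 1"
      using r1 by (intro order_tendstoD) auto
    moreover have "\<forall>\<^sub>F c in at_right (1::real). c > 1"
      by (auto simp: eventually_at_right_less)
    ultimately have "\<forall>\<^sub>F c in at_right (1::real). c > 1 \<and> c ^ 3 * r < 1"
      by eventually_elim auto
    then have "\<exists>c. c > 1 \<and> c ^ 3 * r < 1"
      by (rule eventually_happens'[rotated]) simp
    then show ?thesis using that by blast
  qed
  obtain K where K: "\<And>n. \<bar>hermite n x\<bar> \<le> K * c ^ n * sqrt (fact n)"
    using hermite_growth[OF c(1)] by blast
  obtain L where L: "\<And>n. \<bar>hermite n y\<bar> \<le> L * c ^ n * sqrt (fact n)"
    using hermite_growth[OF c(1)] by blast
  have K0: "K \<ge> 0" using K[of 0] by simp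
  have L0: "L \<ge> 0" using L[of 0] by simp
  have bound: "norm (hermite n x * hermite (n + k) y / fact n * of_real r ^ n)
       \<le> K * L * c * (real (Suc n) * (c ^ 2 * r) ^ n)" for n
  proof -
    have s: "sqrt (fact (n + k)) \<le> real (Suc n) * sqrt (fact n)"
    proof -
      have "fact (n + k) \<le> (real (Suc n))\<^sup>2 * fact n"
        using assms by (cases k) (auto simp: power2_eq_square algebra_simps)
      then have "sqrt (fact (n + k)) \<le> sqrt ((real (Suc n))\<^sup>2 * fact n)" by (rule real_sqrt_le_mono)
      then show ?thesis by (simp add: real_sqrt_mult)
    qed
    have ck: "c ^ (n + k) \<le> c ^ n * c"
      using power_increasing[of "n + k" "Suc n" c] assms c by (simp add: mult.commute)
    have "\<bar>hermite n x\<bar> * \<bar>hermite (n + k) y\<bar> \<le> (K * c ^ n * sqrt (fact n)) * (L * c ^ (n + k) * sqrt (fact (n + k)))"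
      using K0 c by (intro mult_mono K L) auto
    also have "\<dots> \<le> (K * c ^ n * sqrt (fact n)) * (L * (c ^ n * c) * (real (Suc n) * sqrt (fact n)))"
      using K0 L0 c by (intro mult_left_mono mult_mono ck s) auto
    also have "\<dots> = K * L * c * real (Suc n) * (c ^ 2) ^ n * (sqrt (fact n) * sqrt (fact n))"
      by (simp only: power2_eq_square power_mult_distrib mult_ac)
    also have "\<dots> = K * L * c * real (Suc n) * (c ^ 2) ^ n * fact n"
      by simp
    finally have "\<bar>hermite n x\<bar> * \<bar>hermite (n + k) y\<bar> / fact n \<le> K * L * c * real (Suc n) * (c ^ 2) ^ n"
      by (simp add: divide_le_eq)
    then have "\<bar>hermite n x\<bar> * \<bar>hermite (n + k) y\<bar> / fact n * r ^ n \<le> K * L * c * real (Suc n) * (c ^ 2) ^ n * r ^ n"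
      using r by (intro mult_right_mono) auto
    then show ?thesis using r
      by (simp add: abs_mult power_mult_distrib mult_ac)
  qed
  have c2: "c ^ 2 * r < 1"
  proof -
    have "c ^ 2 * r \<le> c ^ 3 * r" using c r by (intro mult_right_mono power_increasing) auto
    then show ?thesis using c by linarith
  qed
  have sm: "summable (\<lambda>n. K * L * c * (real (Suc n) * (c ^ 2 * r) ^ n))"
  proof (intro summable_mult)
    \<comment> \<open>\<open>diffs\<close> of the constant sequence 1 is n + 1: this is the
      differentiated geometric series.\<close>
    have "summable (\<lambda>n. diffs (\<lambda>n. 1::real) n * (c ^ 2 * r) ^ n)"
      using c2 c r by (intro termdiff_converges[of _ 1]) (auto simp: summable_geometric)
    then show "summable (\<lambda>n. real (Suc n) * (c ^ 2 * r) ^ n)" by (simp add: diffs_def)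
  qed
  show "summable (\<lambda>n. fps_nth (Abs_fps (\<lambda>n. hermite n x * hermite (n + k) y / fact n)) n * of_real r ^ n)"
    by (rule summable_comparison_test'[OF sm, of 0]) (use bound in auto)
qed

text \<open>The differential equation closes on three series: S with equal indices, and A, B with
  one index raised. The recurrence in x and in y gives two linear relations that express B as a
  rational multiple of S, and a third relation expresses S' through B and S.\<close>

lemma mehler:
  fixes r x y :: real
  assumes r: "\<bar>r\<bar> < 1"
  shows "(\<lambda>n. r ^ n * (hermite n x * hermite n y / fact n)) sums
     (exp ((2 * x * y * r - (x\<^sup>2 + y\<^sup>2) * r\<^sup>2) / (1 - r\<^sup>2)) / sqrt (1 - r\<^sup>2))"
proof -
  define Sf where "Sf = Abs_fps (\<lambda>n. hermite n x * hermite n y / fact n)"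
  define Af where "Af = Abs_fps (\<lambda>n. hermite (Suc n) x * hermite n y / fact n)"
  define Bf where "Bf = Abs_fps (\<lambda>n. hermite n x * hermite (Suc n) y / fact n)"
  have rad: "fps_conv_radius Sf \<ge> 1" "fps_conv_radius Bf \<ge> 1" "fps_conv_radius Af \<ge> 1"
    using fps_conv_radius_hermite[of 0 x y] fps_conv_radius_hermite[of 1 x y]
      fps_conv_radius_hermite[of 1 y x]
    by (simp_all add: Sf_def Bf_def Af_def mult.commute)
  \<comment> \<open>The factor n + 1 of the recurrence cancels against the factorial; this is what
    turns an index shift into multiplication by \<open>fps_X\<close>.\<close>
  have fact_cancel: "real (Suc m) * c / fact (Suc m) = c / fact m" for m and c :: real
    by (simp del: of_nat_Suc)
  have fA: "Af = fps_const (sqrt 2 * x) * Sf - fps_X * Bf"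
  proof (rule fps_ext)
    fix n show "fps_nth Af n = fps_nth (fps_const (sqrt 2 * x) * Sf - fps_X * Bf) n"
      using fact_cancel[of "n - 1" "hermite (n - 1) x * hermite n y"]
        fact_cancel[of "n - 1" "hermite n x * hermite (n - 1) y"]
      by (cases n) (simp_all add: Af_def Sf_def Bf_def left_diff_distrib right_diff_distrib
            diff_divide_distrib mult_ac del: of_nat_Suc fact_Suc)
  qed
  have fB: "Bf = fps_const (sqrt 2 * y) * Sf - fps_X * Af"
  proof (rule fps_ext)
    fix n show "fps_nth Bf n = fps_nth (fps_const (sqrt 2 * y) * Sf - fps_X * Af) n"
      using fact_cancel[of "n - 1" "hermite (n - 1) x * hermite n y"]
        fact_cancel[of "n - 1" "hermite n x * hermite (n - 1) y"]
      by (cases n) (simp_all add: Af_def Sf_def Bf_def left_diff_distrib right_diff_distrib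
            diff_divide_distrib mult_ac del: of_nat_Suc fact_Suc)
  qed
  have fS: "fps_deriv Sf = fps_const (sqrt 2 * x) * Bf - fps_X * (fps_const (sqrt 2 * y) * Bf)
      + fps_X * (Sf + fps_X * fps_deriv Sf)"
  proof (rule fps_ext)
    fix n
    have d: "fps_nth (fps_deriv Sf) n = hermite (Suc n) x * hermite (Suc n) y / fact n" for n
      using fact_cancel[of n "hermite (Suc n) x * hermite (Suc n) y"]
      by (simp add: Sf_def mult.assoc del: of_nat_Suc fact_Suc)
    show "fps_nth (fps_deriv Sf) n = fps_nth (fps_const (sqrt 2 * x) * Bf - fps_X * (fps_const (sqrt 2 * y) * Bf)
      + fps_X * (Sf + fps_X * fps_deriv Sf)) n"
    proof (cases n)
      case 0 then show ?thesis using d[of 0] by (simp add: Bf_def)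
    next
      case (Suc m)
      have e: "fps_nth (fps_X * fps_deriv Sf) m = real m * (hermite m x * hermite m y / fact m)"
        by (cases m) (simp_all add: d Sf_def)
      \<comment> \<open>The recurrence is applied in x, then in y inside the second product. The
        resulting square of m + 1 is split so that one factor cancels in the factorial and the
        other, as 1 + m, gives \<open>Sf\<close> plus its Euler derivative.\<close>
      have h: "hermite (Suc (Suc m)) x * hermite (Suc (Suc m)) y =
          sqrt 2 * x * (hermite (Suc m) x * hermite (Suc (Suc m)) y)
          - real (Suc m) * (sqrt 2 * y * (hermite m x * hermite (Suc m) y))
          + real (Suc m) * (hermite m x * hermite m y + real m * (hermite m x * hermite m y))"
        by (simp add: algebra_simps)
      have "fps_nth (fps_deriv Sf) n = sqrt 2 * x * (hermite (Suc m) x * hermite (Suc (Suc m)) y) / fact (Suc m)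
          - sqrt 2 * y * (hermite m x * hermite (Suc m) y) / fact m
          + (hermite m x * hermite m y + real m * (hermite m x * hermite m y)) / fact m"
        unfolding Suc d h add_divide_distrib[of _ _ "fact (Suc m)"] diff_divide_distrib fact_cancel ..
      then show ?thesis
        by (simp add: Suc e Bf_def Sf_def add_divide_distrib del: fact_Suc hermite.simps)
    qed
  qed
  define S where "S = eval_fps Sf"
  define A where "A = eval_fps Af"
  define B where "B = eval_fps Bf"
  have eA: "A z = sqrt 2 * x * S z - z * B z" and eB: "B z = sqrt 2 * y * S z - z * A z"
    and eS: "eval_fps (fps_deriv Sf) z = sqrt 2 * x * B z - z * (sqrt 2 * y * B z)
      + z * (S z + z * eval_fps (fps_deriv Sf) z)"
    if z: "\<bar>z\<bar> < 1" for z
  proof -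
    have z1: "ereal (norm z) < 1" using z by simp
    have lt: "ereal (norm z) < fps_conv_radius f" if "fps_conv_radius f \<ge> 1" for f :: "real fps"
      using z1 that by (rule less_le_trans)
    have S1: "ereal (norm z) < fps_conv_radius Sf" "ereal (norm z) < fps_conv_radius Af"
      "ereal (norm z) < fps_conv_radius Bf" using lt rad by auto
    have S2: "ereal (norm z) < fps_conv_radius (fps_deriv Sf)"
      using S1(1) fps_conv_radius_deriv[of Sf] by (rule less_le_trans)
    have X: "ereal (norm z) < fps_conv_radius (fps_X * f)" "eval_fps (fps_X * f) z = z * eval_fps f z"
      if "ereal (norm z) < fps_conv_radius f" for f
    proof -
      show "ereal (norm z) < fps_conv_radius (fps_X * f)"
        using fps_conv_radius_mult[of fps_X f] that by (auto intro: less_le_trans)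
      show "eval_fps (fps_X * f) z = z * eval_fps f z"
        using that by (subst eval_fps_mult) auto
    qed
    have C: "ereal (norm z) < fps_conv_radius (fps_const c * f)" "eval_fps (fps_const c * f) z = c * eval_fps f z"
      if "ereal (norm z) < fps_conv_radius f" for f c
    proof -
      show "ereal (norm z) < fps_conv_radius (fps_const c * f)"
        using fps_conv_radius_mult[of "fps_const c" f] that by (auto intro: less_le_trans)
      show "eval_fps (fps_const c * f) z = c * eval_fps f z"
        using that by (subst eval_fps_mult) auto
    qed
    have P: "ereal (norm z) < fps_conv_radius (f + g)" "eval_fps (f + g) z = eval_fps f z + eval_fps g z"
      "ereal (norm z) < fps_conv_radius (f - g)" "eval_fps (f - g) z = eval_fps f z - eval_fps g z"
      if "ereal (norm z) < fps_conv_radius f" "ereal (norm z) < fps_conv_radius g" for f g :: "real fps"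
      using that fps_conv_radius_add[of f g] fps_conv_radius_diff[of f g]
      by (auto intro!: eval_fps_add eval_fps_diff intro: less_le_trans[of _ "min (fps_conv_radius f) (fps_conv_radius g)"])
    show "A z = sqrt 2 * x * S z - z * B z"
      unfolding A_def B_def S_def using S1 X C P by (subst fA) simp
    show "B z = sqrt 2 * y * S z - z * A z"
      unfolding A_def B_def S_def using S1 X C P by (subst fB) simp
    show "eval_fps (fps_deriv Sf) z = sqrt 2 * x * B z - z * (sqrt 2 * y * B z)
      + z * (S z + z * eval_fps (fps_deriv Sf) z)"
      unfolding B_def S_def using S1 S2 X C P by (subst fS) simp
  qed
  \<comment> \<open>\<open>E\<close> is the reciprocal of the claimed closed form, so the goal
    becomes S * E = 1.\<close>
  define E where "E = (\<lambda>z. sqrt (1 - z\<^sup>2) * exp (- (2 * x * y * z - (x\<^sup>2 + y\<^sup>2) * z\<^sup>2) / (1 - z\<^sup>2)))"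
  have SE: "((\<lambda>z. S z * E z) has_real_derivative 0) (at z)" if z: "\<bar>z\<bar> < 1" for z
  proof -
    have z2: "1 - z\<^sup>2 > 0" using z by (simp add: abs_square_less_1)
    define D where "D = eval_fps (fps_deriv Sf) z"
    \<comment> \<open>A is eliminated from the two linear relations; their determinant 1 - z^2 does
      not vanish for \<open>\<bar>z\<bar> < 1\<close>.\<close>
    have B1: "(1 - z\<^sup>2) * B z = sqrt 2 * (y - z * x) * S z"
      using eA[OF z] eB[OF z] by algebra
    have D1: "(1 - z\<^sup>2) * D = sqrt 2 * (x - z * y) * B z + z * S z"
      using eS[OF z] unfolding D_def by algebra
    have "(1 - z\<^sup>2) * ((1 - z\<^sup>2) * D) = sqrt 2 * (x - z * y) * ((1 - z\<^sup>2) * B z) + (1 - z\<^sup>2) * (z * S z)"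
      unfolding D1 by (simp add: algebra_simps)
    also have "\<dots> = (sqrt 2 * sqrt 2) * (x - z * y) * (y - z * x) * S z + (1 - z\<^sup>2) * (z * S z)"
      unfolding B1 by (simp only: mult_ac)
    finally have D2: "(1 - z\<^sup>2)\<^sup>2 * D = (2 * (x - z * y) * (y - z * x) + (1 - z\<^sup>2) * z) * S z"
      by (simp add: power2_eq_square algebra_simps)
    define w where "w = 1 - z\<^sup>2"
    have w: "w > 0" "sqrt w * sqrt w = w" using z2 by (simp_all add: w_def)
    have dS: "(S has_real_derivative D) (at z)"
      unfolding S_def D_def by (rule has_field_derivative_eval_fps) (use rad z in \<open>auto intro: less_le_trans[of _ 1]\<close>)
    have dw: "((\<lambda>z. 1 - z\<^sup>2) has_real_derivative - 2 * z) (at z)"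
      by (auto intro!: derivative_eq_intros)
    let ?x = "exp (- (2 * x * y * z - (x\<^sup>2 + y\<^sup>2) * z\<^sup>2) / w)"
    have dE: "(E has_real_derivative (- z / sqrt w * ?x + sqrt w *
         (?x * ((- (2 * x * y - (x\<^sup>2 + y\<^sup>2) * (2 * z)) * w - (2 * x * y * z - (x\<^sup>2 + y\<^sup>2) * z\<^sup>2) * (2 * z)) / w\<^sup>2)))) (at z)"
      unfolding E_def w_def using z2
      by (auto intro!: derivative_eq_intros simp: field_simps power2_eq_square)
    have E: "E z = sqrt w * ?x" by (simp add: E_def w_def)
    have "D * E z + S z * (- z / sqrt w * ?x + sqrt w *
         (?x * ((- (2 * x * y - (x\<^sup>2 + y\<^sup>2) * (2 * z)) * w - (2 * x * y * z - (x\<^sup>2 + y\<^sup>2) * z\<^sup>2) * (2 * z)) / w\<^sup>2)))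
       = sqrt w * ?x * (D + S z * (- z / w + (- (2 * x * y - (x\<^sup>2 + y\<^sup>2) * (2 * z)) * w - (2 * x * y * z - (x\<^sup>2 + y\<^sup>2) * z\<^sup>2) * (2 * z)) / w\<^sup>2))"
    proof -
      have "- z / sqrt w = sqrt w * (- z / w)" using w by (simp add: field_simps)
      then show ?thesis unfolding E by (simp only:) (simp add: algebra_simps)
    qed
    also have "D + S z * (- z / w + (- (2 * x * y - (x\<^sup>2 + y\<^sup>2) * (2 * z)) * w - (2 * x * y * z - (x\<^sup>2 + y\<^sup>2) * z\<^sup>2) * (2 * z)) / w\<^sup>2)
      = (w\<^sup>2 * D + S z * (- z * w + (- (2 * x * y - (x\<^sup>2 + y\<^sup>2) * (2 * z)) * w - (2 * x * y * z - (x\<^sup>2 + y\<^sup>2) * z\<^sup>2) * (2 * z)))) / w\<^sup>2"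
      using w by (simp add: field_simps power2_eq_square)
    also have "w\<^sup>2 * D + S z * (- z * w + (- (2 * x * y - (x\<^sup>2 + y\<^sup>2) * (2 * z)) * w - (2 * x * y * z - (x\<^sup>2 + y\<^sup>2) * z\<^sup>2) * (2 * z))) = 0"
      unfolding w_def D2 by (simp add: algebra_simps power2_eq_square)
    finally have "D * E z + S z * (- z / sqrt w * ?x + sqrt w *
         (?x * ((- (2 * x * y - (x\<^sup>2 + y\<^sup>2) * (2 * z)) * w - (2 * x * y * z - (x\<^sup>2 + y\<^sup>2) * z\<^sup>2) * (2 * z)) / w\<^sup>2))) = 0"
      by simp
    then show ?thesis
      using DERIV_mult[OF dS dE] by (simp add: mult.commute add.commute)
  qed
  have "S r * E r = S 0 * E 0"
    by (rule DERIV_isconst3[of "-1" 1 r 0 "\<lambda>z. S z * E z"]) (use r SE in auto)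
  also have "\<dots> = 1" by (simp add: S_def E_def eval_fps_at_0 Sf_def)
  finally have SE1: "S r * E r = 1" .
  have r2: "1 - r\<^sup>2 > 0" using r by (simp add: abs_square_less_1)
  have "S r = exp ((2 * x * y * r - (x\<^sup>2 + y\<^sup>2) * r\<^sup>2) / (1 - r\<^sup>2)) / sqrt (1 - r\<^sup>2)"
  proof -
    have "E r = sqrt (1 - r\<^sup>2) / exp ((2 * x * y * r - (x\<^sup>2 + y\<^sup>2) * r\<^sup>2) / (1 - r\<^sup>2))"
      unfolding E_def minus_divide_left[symmetric] exp_minus by (simp add: divide_inverse)
    with SE1 r2 show ?thesis by (simp add: field_simps)
  qed
  moreover have "(\<lambda>n. fps_nth Sf n * r ^ n) sums S r"
    unfolding S_def by (rule sums_eval_fps) (use rad r in \<open>auto intro: less_le_trans[of _ 1]\<close>)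
  ultimately show ?thesis by (simp add: Sf_def mult.commute)
qed

section \<open>Position kernels\<close>

text \<open>The exponent is written in x + y and x - y because at the arguments q - y and q + y it
  splits into - q^2 / 2 and - 2 * y^2, as the Wigner integral requires.\<close>

definition thermal_kernel :: "real \<Rightarrow> real \<Rightarrow> real" where
  "thermal_kernel x y = exp (- (x + y)\<^sup>2 / 8 - (x - y)\<^sup>2 / 2) / sqrt (2 * pi)"

lemma sums_thermal_kernel:
  "(\<lambda>j. (1 / 3) ^ j * (fock_real j x * fock_real j y)) sums (3 / 2 * thermal_kernel x y)"
proof -
  have c: "pi powr (- 1 / 4) * pi powr (- 1 / 4) = 1 / sqrt pi"
    by (simp add: powr_add[symmetric] powr_minus_divide powr_half_sqrt)
  define G where "G = exp (- x\<^sup>2 / 2) * exp (- y\<^sup>2 / 2)"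
  have eq: "(1 / 3) ^ j * (fock_real j x * fock_real j y)
      = 1 / sqrt pi * G * ((1 / 3) ^ j * (hermite j x * hermite j y / fact j))" for j
  proof -
    have "fock_real j x * fock_real j y = (pi powr (- 1 / 4) * pi powr (- 1 / 4)) * G *
        (hermite j x * hermite j y / (sqrt (fact j) * sqrt (fact j)))"
      unfolding fock_real_def G_def by (simp only: divide_inverse inverse_mult_distrib mult_ac)
    then show ?thesis unfolding c by simp
  qed
  have s8: "sqrt (8 / 9) = 2 * sqrt 2 / 3"
    using real_sqrt_mult[of 4 2] by (simp add: real_sqrt_divide)
  have "(\<lambda>j. (1 / 3) ^ j * (fock_real j x * fock_real j y)) sums
     (1 / sqrt pi * G * (exp ((2 * x * y * (1 / 3) - (x\<^sup>2 + y\<^sup>2) * (1 / 3)\<^sup>2) / (1 - (1 / 3)\<^sup>2)) / sqrt (1 - (1 / 3)\<^sup>2)))"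
    unfolding eq by (intro sums_mult mehler) auto
  also have "1 / sqrt pi * G * (exp ((2 * x * y * (1 / 3) - (x\<^sup>2 + y\<^sup>2) * (1 / 3)\<^sup>2) / (1 - (1 / 3)\<^sup>2)) / sqrt (1 - (1 / 3)\<^sup>2))
    = 1 / sqrt pi / sqrt (8 / 9) * (G * exp ((2 * x * y * (1 / 3) - (x\<^sup>2 + y\<^sup>2) * (1 / 3)\<^sup>2) / (1 - (1 / 3)\<^sup>2)))"
    by (simp add: power2_eq_square)
  also have "G * exp ((2 * x * y * (1 / 3) - (x\<^sup>2 + y\<^sup>2) * (1 / 3)\<^sup>2) / (1 - (1 / 3)\<^sup>2))
      = exp (- (x + y)\<^sup>2 / 8 - (x - y)\<^sup>2 / 2)"
    unfolding G_def exp_add[symmetric]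
    by (rule arg_cong[of _ _ exp]) (simp add: field_simps power2_eq_square)
  finally show ?thesis
    by (simp add: thermal_kernel_def s8 real_sqrt_mult mult_ac)
qed

text \<open>The constant is at most 1 because (3/2)^2 \<le> 2 * pi. This diagonal Gaussian is the
  source of all domination below.\<close>

lemma thermal_kernel_diag_le: "3 / 2 * thermal_kernel x x \<le> exp (- x\<^sup>2 / 2)"
proof -
  have "3 / 2 \<le> sqrt (2 * pi)"
    using pi_gt3 by (intro real_le_rsqrt) (simp add: power2_eq_square)
  then have "3 / 2 / sqrt (2 * pi) \<le> 1" by (simp add: divide_le_eq)
  then have "3 / 2 / sqrt (2 * pi) * exp (- x\<^sup>2 / 2) \<le> 1 * exp (- x\<^sup>2 / 2)"
    by (intro mult_right_mono) auto
  moreover have "- (x + x)\<^sup>2 / 8 - (x - x)\<^sup>2 / 2 = - x\<^sup>2 / 2" by (simp add: power2_eq_square)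
  ultimately show ?thesis by (simp add: thermal_kernel_def)
qed

text \<open>
  Weighted AM-GM on each term, with weight \<open>exp (- y\<^sup>2 / 4)\<close>, reduces the
  off-diagonal sum to two diagonal ones.
\<close>

lemma sum_abs_fock_real_le:
  "(\<Sum>j<m. (1 / 3) ^ j * \<bar>fock_real j x * fock_real j y\<bar>) \<le> exp (- y\<^sup>2 / 4)"
proof -
  define l where "l = exp (- y\<^sup>2 / 4)"
  have l: "l > 0" by (simp add: l_def)
  have diag: "(\<Sum>j<m. (1 / 3) ^ j * (fock_real j z * fock_real j z)) \<le> exp (- z\<^sup>2 / 2)" for z
    using sum_le_suminf[OF sums_summable[OF sums_thermal_kernel[of z z]], of "{..<m}"]
      sums_unique[OF sums_thermal_kernel[of z z]] thermal_kernel_diag_le[of z] by auto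
  have amgm: "\<bar>a * b\<bar> \<le> (l * (a * a) + b * b / l) / 2" for a b :: real
  proof -
    have "0 \<le> (l * \<bar>a\<bar> - \<bar>b\<bar>)\<^sup>2" by simp
    then have "2 * l * \<bar>a * b\<bar> \<le> l * l * (a * a) + b * b"
      by (simp add: power2_eq_square algebra_simps abs_mult)
    then show ?thesis using l by (simp add: field_simps)
  qed
  have "(\<Sum>j<m. (1 / 3) ^ j * \<bar>fock_real j x * fock_real j y\<bar>)
      \<le> (\<Sum>j<m. (1 / 3) ^ j * ((l * (fock_real j x * fock_real j x) + fock_real j y * fock_real j y / l) / 2))"
    by (intro sum_mono mult_left_mono amgm) auto
  also have "\<dots> = (l * (\<Sum>j<m. (1 / 3) ^ j * (fock_real j x * fock_real j x))
       + (\<Sum>j<m. (1 / 3) ^ j * (fock_real j y * fock_real j y)) / l) / 2"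
    by (simp add: sum_distrib_left sum_divide_distrib sum.distrib[symmetric] field_simps)
  also have "\<dots> \<le> (l * exp (- x\<^sup>2 / 2) + exp (- y\<^sup>2 / 2) / l) / 2"
    using l by (intro divide_right_mono add_mono mult_left_mono diag) auto
  also have "\<dots> \<le> (l * 1 + l) / 2"
  proof -
    have "exp (- y\<^sup>2 / 2) / l = l" by (simp add: l_def exp_diff[symmetric])
    then show ?thesis using l by (intro divide_right_mono add_mono mult_left_mono) auto
  qed
  finally show ?thesis by (simp add: l_def)
qed

text \<open>A single term is at most the whole diagonal sum of nonnegative terms, so Mehler's closed
  form replaces an estimate of a polynomial against a Gaussian. The weight 3^(-j) becomes the
  constant sqrt (3^j).\<close>

lemma abs_fock_real_le: "\<exists>C. \<forall>y. \<bar>fock_real j y\<bar> \<le> C * exp (- y\<^sup>2 / 4)"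
proof (intro exI allI)
  fix y
  have "(\<Sum>i<Suc j. (1 / 3) ^ i * \<bar>fock_real i y * fock_real i y\<bar>) \<ge> (1 / 3) ^ j * \<bar>fock_real j y * fock_real j y\<bar>"
    by (intro member_le_sum) auto
  moreover have "(\<Sum>i<Suc j. (1 / 3) ^ i * \<bar>fock_real i y * fock_real i y\<bar>) \<le> exp (- y\<^sup>2 / 2)"
    using sum_le_suminf[OF sums_summable[OF sums_thermal_kernel[of y y]], of "{..<Suc j}"]
      sums_unique[OF sums_thermal_kernel[of y y]] thermal_kernel_diag_le[of y] by auto
  ultimately have "(1 / 3) ^ j * (fock_real j y)\<^sup>2 \<le> exp (- y\<^sup>2 / 2)"
    by (simp add: power2_eq_square)
  then have "(fock_real j y)\<^sup>2 \<le> 3 ^ j * exp (- y\<^sup>2 / 2)"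
    by (simp add: power_divide field_simps)
  also have "\<dots> = (sqrt (3 ^ j) * exp (- y\<^sup>2 / 4))\<^sup>2"
    by (simp add: power_mult_distrib exp_of_nat_mult[symmetric])
  finally show "\<bar>fock_real j y\<bar> \<le> sqrt (3 ^ j) * exp (- y\<^sup>2 / 4)"
    by (rule abs_le_square_iff[THEN iffD2, THEN order_trans, of _ "sqrt (3 ^ j) * exp (- y\<^sup>2 / 4)"]) simp
qed

lemma thermal_kernel_le: "\<bar>thermal_kernel x y\<bar> \<le> exp (- y\<^sup>2 / 4)"
proof -
  have "- (x + y)\<^sup>2 / 8 - (x - y)\<^sup>2 / 2 \<le> - y\<^sup>2 / 4"
  proof -
    \<comment> \<open>The difference of the two exponents is 5/8 x^2 - 3/4 x y + 3/8 y^2; this is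
      its completed square in x.\<close>
    have "0 \<le> (5 * x - 3 * y)\<^sup>2 / 40 + 3 * y\<^sup>2 / 20" by simp
    then show ?thesis by (simp add: power2_eq_square field_simps)
  qed
  moreover have "1 \<le> sqrt (2 * pi)"
    using pi_gt3 by (intro real_le_rsqrt) auto
  ultimately have "exp (- (x + y)\<^sup>2 / 8 - (x - y)\<^sup>2 / 2) * 1 \<le> exp (- y\<^sup>2 / 4) * sqrt (2 * pi)"
    by (intro mult_mono) auto
  then show ?thesis using \<open>1 \<le> sqrt (2 * pi)\<close>
    by (simp add: thermal_kernel_def divide_le_eq)
qed

lemma continuous_on_thermal_kernel [continuous_intros]:
  assumes "continuous_on S f" "continuous_on S g"
  shows "continuous_on S (\<lambda>z. thermal_kernel (f z) (g z))"
  unfolding thermal_kernel_def using assms by (intro continuous_intros) auto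

section \<open>Integrability against Gaussian weights\<close>

lemma integrable_exp_minus_square:
  assumes "a > 0"
  shows "integrable lborel (\<lambda>y::real. exp (- a * y\<^sup>2))"
proof -
  have "integrable lborel (\<lambda>y. normal_density 0 (sqrt (1 / (2 * a))) y * sqrt (2 * pi * (1 / (2 * a))))"
    using assms by (intro integrable_mult_left integrable_normal_density) auto
  moreover have "normal_density 0 (sqrt (1 / (2 * a))) y * sqrt (2 * pi * (1 / (2 * a))) = exp (- a * y\<^sup>2)" for y
    using assms by (simp add: normal_density_def mult.commute)
  ultimately show ?thesis by (simp only:)
qed

text \<open>The pointwise inequality a * b \<le> a^2 + b^2 takes the place of Cauchy-Schwarz: both
  squares are integrable.\<close>

lemma integrable_gauss_mult_square_integrable:
  assumes "square_integrable f"
  shows "integrable lborel (\<lambda>y. exp (- y\<^sup>2 / 4) * cmod (f y))"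
proof (rule Bochner_Integration.integrable_bound)
  have "integrable lborel (\<lambda>y::real. exp (- (1 / 2) * y\<^sup>2))"
    by (rule integrable_exp_minus_square) simp
  then show "integrable lborel (\<lambda>y. exp (- (1 / 2) * y\<^sup>2) + (cmod (f y))\<^sup>2)"
    using assms by (intro Bochner_Integration.integrable_add) (auto simp: square_integrable_def)
  show "(\<lambda>y. exp (- y\<^sup>2 / 4) * cmod (f y)) \<in> borel_measurable lborel"
    using assms by (auto simp: square_integrable_def)
  have "exp (- y\<^sup>2 / 4) * cmod (f y) \<le> exp (- (1 / 2) * y\<^sup>2) + (cmod (f y))\<^sup>2" for y
  proof -
    have "exp (- (1 / 2) * y\<^sup>2) = (exp (- y\<^sup>2 / 4))\<^sup>2"
      by (simp add: exp_of_nat_mult[symmetric])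
    moreover have "0 \<le> (exp (- y\<^sup>2 / 4) - cmod (f y))\<^sup>2 + (exp (- y\<^sup>2 / 4))\<^sup>2 + (cmod (f y))\<^sup>2" by simp
    ultimately show ?thesis by (simp add: power2_diff)
  qed
  then show "AE y in lborel. norm (exp (- y\<^sup>2 / 4) * cmod (f y)) \<le> norm (exp (- (1 / 2) * y\<^sup>2) + (cmod (f y))\<^sup>2)"
    by (auto simp: abs_mult)
qed

lemma integrable_mult_square_integrable:
  fixes g :: "real \<Rightarrow> real"
  assumes f: "square_integrable f" and g: "continuous_on UNIV g"
    and b: "\<And>y. \<bar>g y\<bar> \<le> C * exp (- y\<^sup>2 / 4)"
  shows "integrable lborel (\<lambda>y. of_real (g y) * f y)"
proof (rule Bochner_Integration.integrable_bound)
  show "integrable lborel (\<lambda>y. C * (exp (- y\<^sup>2 / 4) * cmod (f y)))"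
    by (intro integrable_mult_right integrable_gauss_mult_square_integrable f)
  have [measurable]: "g \<in> borel_measurable borel"
    using g by (rule borel_measurable_continuous_onI)
  show "(\<lambda>y. of_real (g y) * f y) \<in> borel_measurable lborel"
    using f by (auto simp: square_integrable_def)
  have "norm (of_real (g y) * f y) \<le> norm (C * (exp (- y\<^sup>2 / 4) * cmod (f y)))" for y
  proof -
    have "norm (of_real (g y) * f y) \<le> C * exp (- y\<^sup>2 / 4) * cmod (f y)"
      unfolding norm_mult norm_of_real by (intro mult_right_mono b) auto
    also have "\<dots> \<le> norm (C * exp (- y\<^sup>2 / 4) * cmod (f y))" by simp
    finally show ?thesis by (simp only: mult.assoc)
  qed
  then show "AE y in lborel. norm (of_real (g y) * f y) \<le> norm (C * (exp (- y\<^sup>2 / 4) * cmod (f y)))"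
    by simp
qed

text \<open>\<open>integral_suminf\<close> asks for pointwise summable norms and for summable
  integrals of norms. Both follow from one bound on the partial sums that does not depend on their
  length. The bound is available at every x, hence so is the identity, not just at almost every
  x.\<close>

lemma thermal_state_eq:
  assumes f: "square_integrable f"
  shows "thermal_state f x = (LINT y|lborel. of_real (thermal_kernel x y) * f y)"
proof -
  define g where "g = (\<lambda>j y. complex_of_real ((1 / 3) ^ j * (fock_real j x * fock_real j y)) * f y)"
  have int: "integrable lborel (\<lambda>y. of_real (fock_real j y) * f y)" for j
  proof -
    obtain C where "\<And>y. \<bar>fock_real j y\<bar> \<le> C * exp (- y\<^sup>2 / 4)" using abs_fock_real_le by blast
    then show ?thesis
      by (intro integrable_mult_square_integrable f continuous_on_fock_real)
  qed
  have geq: "g j = (\<lambda>y. complex_of_real ((1 / 3) ^ j * fock_real j x) * (of_real (fock_real j y) * f y))" for j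
    by (simp add: g_def fun_eq_iff)
  have intg: "integrable lborel (g j)" for j
    unfolding geq by (intro integrable_mult_right int)
  have ng: "norm (g j y) = (1 / 3) ^ j * \<bar>fock_real j x * fock_real j y\<bar> * cmod (f y)" for j y
    by (simp add: g_def norm_mult abs_mult norm_power norm_divide)
  have partial: "(\<Sum>j<m. norm (g j y)) \<le> exp (- y\<^sup>2 / 4) * cmod (f y)" for m y
    unfolding ng sum_distrib_right[symmetric] by (intro mult_right_mono sum_abs_fock_real_le) auto
  have sm1: "summable (\<lambda>j. norm (g j y))" for y
    using partial by (intro summableI_nonneg_bounded) auto
  have sm2: "summable (\<lambda>j. LINT y|lborel. norm (g j y))"
  proof (rule summableI_nonneg_bounded)
    fix m
    have "(\<Sum>j<m. LINT y|lborel. norm (g j y)) = (LINT y|lborel. (\<Sum>j<m. norm (g j y)))"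
      using intg by (intro Bochner_Integration.integral_sum[symmetric] integrable_norm)
    also have "\<dots> \<le> (LINT y|lborel. exp (- y\<^sup>2 / 4) * cmod (f y))"
      using intg partial
      by (intro integral_mono integrable_gauss_mult_square_integrable f Bochner_Integration.integrable_sum integrable_norm)
    finally show "(\<Sum>j<m. LINT y|lborel. norm (g j y)) \<le> (LINT y|lborel. exp (- y\<^sup>2 / 4) * cmod (f y))" .
  qed auto
  have sg: "(\<Sum>j. g j y) = 3 / 2 * (of_real (thermal_kernel x y) * f y)" for y
  proof -
    have "(\<lambda>j. g j y) sums (of_real (3 / 2 * thermal_kernel x y) * f y)"
      unfolding g_def by (intro sums_mult2 sums_of_real sums_thermal_kernel)
    then show ?thesis by (simp add: sums_iff)
  qed
  have "(\<Sum>j. (1 / 3) ^ j * ketbra (fock j) (fock j) f x) = (\<Sum>j. LINT y|lborel. g j y)"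
  proof (rule suminf_cong)
    fix j
    have "(LINT y|lborel. g j y) = complex_of_real ((1 / 3) ^ j * fock_real j x) * (LINT y|lborel. of_real (fock_real j y) * f y)"
      unfolding geq by (rule integral_mult_right_zero)
    then show "(1 / 3) ^ j * ketbra (fock j) (fock j) f x = (LINT y|lborel. g j y)"
      by (simp add: ketbra_def braket_def fock_eq)
  qed
  also have "\<dots> = (LINT y|lborel. (\<Sum>j. g j y))"
    using sm1 sm2 intg by (intro integral_suminf[symmetric]) auto
  also have "\<dots> = 3 / 2 * (LINT y|lborel. of_real (thermal_kernel x y) * f y)"
    unfolding sg by simp
  finally have series: "(\<Sum>j. (1 / 3) ^ j * ketbra (fock j) (fock j) f x)
      = 3 / 2 * (LINT y|lborel. of_real (thermal_kernel x y) * f y)" .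
  show ?thesis unfolding thermal_state_def series by simp
qed

section \<open>Position kernel of the mixture\<close>

definition psi_real :: "real \<Rightarrow> real \<Rightarrow> real" where
  "psi_real t x = (fock_real 0 x + t * fock_real 3 x) / sqrt (1 + t\<^sup>2)"

lemma psi_state_eq: "psi_state t x = of_real (psi_real t x)"
  by (simp add: psi_state_def psi_real_def fock_eq)

lemma continuous_on_psi_real: "continuous_on S (psi_real t)"
  unfolding psi_real_def by (intro continuous_intros) (use sum_power2_eq_zero_iff[of 1 t] in auto)

lemma abs_psi_real_le: "\<exists>C. \<forall>y. \<bar>psi_real t y\<bar> \<le> C * exp (- y\<^sup>2 / 4)"
proof -
  obtain C where C: "\<And>y. \<bar>fock_real 0 y\<bar> \<le> C * exp (- y\<^sup>2 / 4)" using abs_fock_real_le by blast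
  obtain D where D: "\<And>y. \<bar>fock_real 3 y\<bar> \<le> D * exp (- y\<^sup>2 / 4)" using abs_fock_real_le by blast
  have "\<bar>psi_real t y\<bar> \<le> (C + \<bar>t\<bar> * D) / sqrt (1 + t\<^sup>2) * exp (- y\<^sup>2 / 4)" for y
  proof -
    have "\<bar>fock_real 0 y + t * fock_real 3 y\<bar> \<le> \<bar>fock_real 0 y\<bar> + \<bar>t\<bar> * \<bar>fock_real 3 y\<bar>"
      using abs_triangle_ineq[of "fock_real 0 y" "t * fock_real 3 y"] by (simp add: abs_mult)
    also have "\<dots> \<le> C * exp (- y\<^sup>2 / 4) + \<bar>t\<bar> * (D * exp (- y\<^sup>2 / 4))"
      by (intro add_mono mult_left_mono C D) auto
    finally have "\<bar>fock_real 0 y + t * fock_real 3 y\<bar> \<le> (C + \<bar>t\<bar> * D) * exp (- y\<^sup>2 / 4)"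
      by (simp add: algebra_simps)
    then have "\<bar>fock_real 0 y + t * fock_real 3 y\<bar> / sqrt (1 + t\<^sup>2) \<le> (C + \<bar>t\<bar> * D) * exp (- y\<^sup>2 / 4) / sqrt (1 + t\<^sup>2)"
      by (intro divide_right_mono) auto
    then show ?thesis by (simp add: psi_real_def)
  qed
  then show ?thesis by blast
qed

definition rho_kernel :: "real \<Rightarrow> real \<Rightarrow> real \<Rightarrow> real \<Rightarrow> real" where
  "rho_kernel t \<epsilon> x y = (1 - \<epsilon>) * (psi_real t x * psi_real t y) + \<epsilon> * thermal_kernel x y"

lemma is_position_kernel_rho_state:
  "is_position_kernel (rho_state t \<epsilon>) (\<lambda>x y. of_real (rho_kernel t \<epsilon> x y))"
  unfolding is_position_kernel_def
proof (intro conjI allI impI AE_I2)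
  have c: "continuous_on UNIV (\<lambda>z. psi_real t (h z))" if "continuous_on UNIV h" for h :: "real \<times> real \<Rightarrow> real"
    using continuous_on_compose2[OF continuous_on_psi_real[of UNIV t] that] by simp
  show "continuous_on UNIV (\<lambda>(x, y). complex_of_real (rho_kernel t \<epsilon> x y))"
    unfolding rho_kernel_def case_prod_unfold
    by (intro continuous_intros c)
  fix f and x :: real
  assume f: "square_integrable f"
  obtain C where C: "\<And>y. \<bar>psi_real t y\<bar> \<le> C * exp (- y\<^sup>2 / 4)" using abs_psi_real_le by blast
  have ip: "integrable lborel (\<lambda>y. of_real (psi_real t y) * f y)"
    by (intro integrable_mult_square_integrable[OF f _ C] continuous_on_psi_real)
  have it: "integrable lborel (\<lambda>y. of_real (thermal_kernel x y) * f y)"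
    by (rule integrable_mult_square_integrable[OF f, where C = 1])
       (use thermal_kernel_le in \<open>auto intro!: continuous_intros\<close>)
  have eq: "complex_of_real (rho_kernel t \<epsilon> x y) * f y =
      of_real ((1 - \<epsilon>) * psi_real t x) * (of_real (psi_real t y) * f y)
      + of_real \<epsilon> * (of_real (thermal_kernel x y) * f y)" for y
    by (simp add: rho_kernel_def algebra_simps)
  show "integrable lborel (\<lambda>y. complex_of_real (rho_kernel t \<epsilon> x y) * f y)"
    unfolding eq by (intro Bochner_Integration.integrable_add integrable_mult_right ip it)
  have "(LINT y|lborel. complex_of_real (rho_kernel t \<epsilon> x y) * f y)
     = of_real ((1 - \<epsilon>) * psi_real t x) * (LINT y|lborel. of_real (psi_real t y) * f y)
      + of_real \<epsilon> * (LINT y|lborel. of_real (thermal_kernel x y) * f y)"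
    unfolding eq
    by (subst Bochner_Integration.integral_add)
       (intro integrable_mult_right ip it | simp only: integral_mult_right_zero)+
  then show "rho_state t \<epsilon> f x = (LINT y|lborel. complex_of_real (rho_kernel t \<epsilon> x y) * f y)"
    by (simp add: rho_state_def ketbra_def braket_def psi_state_eq thermal_state_eq[OF f])
qed

lemmas position_kernel_rho_state = position_kernel_eqI[OF is_position_kernel_rho_state]

section \<open>Gaussian moments and the Wigner function\<close>

text \<open>This is the characteristic function of the standard normal law after the substitution x
  = c * y with c = sqrt (2 * a), at the frequency t for which t * c = 2 * p.\<close>

lemma gauss_fourier:
  fixes p a :: real
  assumes a: "a > 0"
  shows "(LINT y|lborel. exp (2 * \<i> * of_real p * of_real y) * of_real (exp (- a * y\<^sup>2)))
    = of_real (sqrt (pi / a) * exp (- p\<^sup>2 / a))"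
proof -
  define c where "c = sqrt (2 * a)"
  have c: "c > 0" "c\<^sup>2 = 2 * a" using a by (simp_all add: c_def)
  define t where "t = 2 * p / c"
  have tc: "t * c = 2 * p" using c by (simp add: t_def)
  have t2: "t\<^sup>2 / 2 = p\<^sup>2 / a" using a c by (simp add: t_def power_divide)
  have "complex_of_real (exp (- (t\<^sup>2) / 2)) = char std_normal_distribution t"
    by (simp add: char_std_normal_distribution)
  also have "\<dots> = (LINT x|lborel. std_normal_density x *\<^sub>R iexp (t * x))"
    unfolding char_def by (subst integral_density) auto
  also have "\<dots> = \<bar>c\<bar> *\<^sub>R (LINT y|lborel. std_normal_density (0 + c * y) *\<^sub>R iexp (t * (0 + c * y)))"
    using c by (intro lborel_integral_real_affine) auto
  also have "(\<lambda>y. std_normal_density (0 + c * y) *\<^sub>R iexp (t * (0 + c * y)))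
     = (\<lambda>y. of_real (1 / sqrt (2 * pi)) * (exp (2 * \<i> * of_real p * of_real y) * of_real (exp (- a * y\<^sup>2))))"
  proof
    fix y
    have 1: "std_normal_density (0 + c * y) = 1 / sqrt (2 * pi) * exp (- a * y\<^sup>2)"
      by (simp add: std_normal_density_def power_mult_distrib c)
    have 2: "t * (0 + c * y) = 2 * p * y" using tc by simp
    show "std_normal_density (0 + c * y) *\<^sub>R iexp (t * (0 + c * y)) =
       of_real (1 / sqrt (2 * pi)) * (exp (2 * \<i> * of_real p * of_real y) * of_real (exp (- a * y\<^sup>2)))"
      unfolding 1 2 by (simp add: scaleR_conv_of_real mult_ac)
  qed
  also have "(LINT y|lborel. of_real (1 / sqrt (2 * pi)) * (exp (2 * \<i> * of_real p * of_real y) * of_real (exp (- a * y\<^sup>2))))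
     = of_real (1 / sqrt (2 * pi)) * (LINT y|lborel. exp (2 * \<i> * of_real p * of_real y) * of_real (exp (- a * y\<^sup>2)))"
    by (rule integral_mult_right_zero)
  finally have eq: "complex_of_real (exp (- (t\<^sup>2) / 2)) = of_real (c / sqrt (2 * pi)) *
      (LINT y|lborel. exp (2 * \<i> * of_real p * of_real y) * of_real (exp (- a * y\<^sup>2)))"
    using c by (simp add: scaleR_conv_of_real)
  have "sqrt (pi / a) = sqrt (2 * pi) / c"
    by (simp add: c_def real_sqrt_divide real_sqrt_mult)
  then have "complex_of_real (sqrt (pi / a) * exp (- p\<^sup>2 / a)) = of_real (sqrt (2 * pi) / c) * complex_of_real (exp (- (t\<^sup>2) / 2))"
    using t2 by simp
  also have "\<dots> = (LINT y|lborel. exp (2 * \<i> * of_real p * of_real y) * of_real (exp (- a * y\<^sup>2)))"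
    unfolding eq using c by simp
  finally show ?thesis by simp
qed

lemma integrable_gauss_moment:
  "integrable lborel (\<lambda>y. of_real (y ^ k) * (exp (2 * \<i> * of_real p * of_real y) * of_real (exp (- y\<^sup>2))))"
proof -
  have "integrable lborel (\<lambda>y. std_normal_density (0 + sqrt 2 * y) * \<bar>0 + sqrt 2 * y\<bar> ^ k)"
    by (rule lborel_integrable_real_affine) (auto intro: integrable_std_normal_moment_abs)
  then have "integrable lborel (\<lambda>y. (sqrt (2 * pi) / sqrt 2 ^ k) * (std_normal_density (0 + sqrt 2 * y) * \<bar>0 + sqrt 2 * y\<bar> ^ k))"
    by (rule integrable_mult_right)
  moreover have "(sqrt (2 * pi) / sqrt 2 ^ k) * (std_normal_density (0 + sqrt 2 * y) * \<bar>0 + sqrt 2 * y\<bar> ^ k)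
     = \<bar>y\<bar> ^ k * exp (- y\<^sup>2)" for y
    by (simp add: std_normal_density_def power_mult_distrib abs_mult)
  ultimately have "integrable lborel (\<lambda>y::real. \<bar>y\<bar> ^ k * exp (- y\<^sup>2))" by (simp only:)
  then show ?thesis
    by (rule Bochner_Integration.integrable_bound)
       (auto simp: norm_mult norm_power power_abs)
qed

text \<open>The derivative of y^k * exp (2 \<i> p y - y^2) integrates to 0 over the line, which is a
  three-term relation between moments. At k = 0 the truncated index k - 1 meets the coefficient
  0.\<close>

lemma gauss_moment_rec:
  defines "m \<equiv> \<lambda>k p. LINT y|lborel. of_real (y ^ k) * (exp (2 * \<i> * of_real p * of_real y) * of_real (exp (- y\<^sup>2)))"
  shows "m (Suc k) p = \<i> * of_real p * m k p + of_nat k / 2 * m (k - 1) p"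
proof -
  let ?e = "\<lambda>y::real. exp (2 * \<i> * of_real p * of_real y) * of_real (exp (- y\<^sup>2))"
  let ?F = "\<lambda>y::real. of_real (y ^ k) * ?e y"
  let ?f = "\<lambda>y::real. of_nat k * (of_real (y ^ (k - 1)) * ?e y) + 2 * \<i> * of_real p * (of_real (y ^ k) * ?e y)
      - 2 * (of_real (y ^ Suc k) * ?e y)"
  have int: "integrable lborel ?f"
    by (intro Bochner_Integration.integrable_diff Bochner_Integration.integrable_add integrable_mult_right integrable_gauss_moment)
  have deriv: "(?F has_vector_derivative ?f y) (at y)" for y
  proof -
    \<comment> \<open>Merging the exponentials gives the restriction of an entire function, whose
      complex derivative can then be taken along the real line.\<close>
    have e: "?e = (\<lambda>y. exp (2 * \<i> * of_real p * of_real y - (of_real y)\<^sup>2))"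
      by (auto simp: fun_eq_iff exp_diff exp_of_real[symmetric] exp_minus field_simps)
    have "((\<lambda>z. z ^ k * exp (2 * \<i> * of_real p * z - z\<^sup>2)) has_field_derivative
       (of_nat k * (z ^ (k - 1) * exp (2 * \<i> * of_real p * z - z\<^sup>2))
         + 2 * \<i> * of_real p * (z ^ k * exp (2 * \<i> * of_real p * z - z\<^sup>2))
         - 2 * (z ^ Suc k * exp (2 * \<i> * of_real p * z - z\<^sup>2)))) (at z)" for z
      by (auto intro!: derivative_eq_intros simp: algebra_simps)
    from has_vector_derivative_real_field[OF this[of "of_real y"]]
    show ?thesis unfolding fun_cong[OF e] by (simp add: o_def)
  qed
  have lim: "(?F \<longlongrightarrow> 0) at_top" "(?F \<longlongrightarrow> 0) at_bot"
  proof -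
    \<comment> \<open>One term of the exponential series dominates the power, which leaves a limit
      free of k.\<close>
    have nb: "norm (?F y) \<le> fact k * exp (\<bar>y\<bar> - y\<^sup>2)" for y
    proof -
      have "\<bar>y\<bar> ^ k / fact k \<le> exp \<bar>y\<bar>"
        using sum_le_suminf[OF summable_exp_generic[of "\<bar>y\<bar>"], of "{k}"]
        by (simp add: exp_def divide_inverse mult.commute)
      then have "\<bar>y\<bar> ^ k \<le> fact k * exp \<bar>y\<bar>" by (simp add: divide_le_eq mult.commute)
      then have "\<bar>y\<bar> ^ k * exp (- y\<^sup>2) \<le> fact k * exp \<bar>y\<bar> * exp (- y\<^sup>2)" by (intro mult_right_mono) auto
      then show ?thesis by (simp add: norm_mult norm_power exp_add[symmetric] mult.assoc)
    qed
    have "((\<lambda>y::real. exp (\<bar>y\<bar> - y\<^sup>2)) \<longlongrightarrow> 0) at_top" by real_asymp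
    then have "((\<lambda>y::real. fact k * exp (\<bar>y\<bar> - y\<^sup>2)) \<longlongrightarrow> 0) at_top"
      by (rule tendsto_mult_right_zero)
    then show "(?F \<longlongrightarrow> 0) at_top"
      by (rule Lim_null_comparison[OF always_eventually, rotated]) (rule allI, rule nb)
    have "((\<lambda>y::real. exp (\<bar>y\<bar> - y\<^sup>2)) \<longlongrightarrow> 0) at_bot" by real_asymp
    then have "((\<lambda>y::real. fact k * exp (\<bar>y\<bar> - y\<^sup>2)) \<longlongrightarrow> 0) at_bot"
      by (rule tendsto_mult_right_zero)
    then show "(?F \<longlongrightarrow> 0) at_bot"
      by (rule Lim_null_comparison[OF always_eventually, rotated]) (rule allI, rule nb)
  qed
  have "(LBINT y=-\<infinity>..\<infinity>. ?f y) = 0 - 0"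
  proof (rule interval_integral_FTC_integrable)
    show "set_integrable lborel (einterval (-\<infinity>) \<infinity>) ?f"
      unfolding set_integrable_def using int by simp
    show "isCont ?f y" for y by (intro continuous_intros)
    show "((?F \<circ> real_of_ereal) \<longlongrightarrow> 0) (at_right (- \<infinity>))"
      using lim(2) unfolding ereal_tendsto_simps1 .
    show "((?F \<circ> real_of_ereal) \<longlongrightarrow> 0) (at_left \<infinity>)"
      using lim(1) unfolding ereal_tendsto_simps1 .
  qed (use deriv in auto)
  then have "integral\<^sup>L lborel ?f = 0"
    by (simp add: interval_lebesgue_integral_def set_lebesgue_integral_def)
  moreover have "integral\<^sup>L lborel ?f = of_nat k * m (k - 1) p + 2 * \<i> * of_real p * m k p - 2 * m (Suc k) p"
    unfolding m_def integral_mult_right_zero[symmetric]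
    by (subst Bochner_Integration.integral_diff Bochner_Integration.integral_add;
        (intro Bochner_Integration.integrable_add integrable_mult_right integrable_gauss_moment)?)+ (rule refl)
  ultimately show ?thesis by (simp add: field_simps)
qed

definition gauss_moment :: "nat \<Rightarrow> real \<Rightarrow> complex" where
  "gauss_moment k p =
     (LINT y|lborel. of_real (y ^ k) * (exp (2 * \<i> * of_real p * of_real y) * of_real (exp (- y\<^sup>2))))"

text \<open>The odd moments are needed as links of the recurrence. Each passage to the next even
  moment brings one factor \<i> * \<i>, hence the alternating leading signs.\<close>

lemma gauss_moment_even:
  "gauss_moment 0 p = of_real (sqrt pi * exp (- p\<^sup>2))"
  "gauss_moment 2 p = of_real ((1 / 2 - p\<^sup>2) * (sqrt pi * exp (- p\<^sup>2)))"
  "gauss_moment 4 p = of_real ((p ^ 4 - 3 * p\<^sup>2 + 3 / 4) * (sqrt pi * exp (- p\<^sup>2)))"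
  "gauss_moment 6 p = of_real ((- (p ^ 6) + 15 / 2 * p ^ 4 - 45 / 4 * p\<^sup>2 + 15 / 8) * (sqrt pi * exp (- p\<^sup>2)))"
proof -
  define z where "z = complex_of_real (sqrt pi * exp (- p\<^sup>2))"
  define w where "w = complex_of_real p"
  have ii: "\<i> * \<i> = -1" by simp
  show m0: "gauss_moment 0 p = of_real (sqrt pi * exp (- p\<^sup>2))"
    using gauss_fourier[of 1 p] by (simp add: gauss_moment_def)
  note rec = gauss_moment_rec[of _ p, folded gauss_moment_def, folded w_def]
  have m1: "gauss_moment 1 p = \<i> * w * z"
    using rec[of 0] m0 by (simp add: z_def)
  have m2: "gauss_moment 2 p = (1 / 2 - w ^ 2) * z"
  proof -
    have "gauss_moment 2 p = \<i> * w * gauss_moment 1 p + 1 / 2 * z"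
      using rec[of 1] m0 by (simp add: z_def numeral_2_eq_2)
    then show ?thesis unfolding m1 using ii by algebra
  qed
  have m3: "gauss_moment 3 p = \<i> * w * (3 / 2 - w ^ 2) * z"
  proof -
    have "gauss_moment 3 p = \<i> * w * gauss_moment 2 p + 1 * gauss_moment 1 p"
      using rec[of 2] by simp
    then show ?thesis unfolding m1 m2 by (simp add: field_simps)
  qed
  have m4: "gauss_moment 4 p = (w ^ 4 - 3 * w ^ 2 + 3 / 4) * z"
  proof -
    have "gauss_moment 4 p = \<i> * w * gauss_moment 3 p + 3 / 2 * gauss_moment 2 p"
      using rec[of 3] by simp
    also have "\<i> * w * gauss_moment 3 p = (\<i> * \<i>) * (w * w) * (3 / 2 - w ^ 2) * z"
      unfolding m3 by (simp only: mult_ac)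
    also have "\<i> * \<i> * (w * w) * (3 / 2 - w ^ 2) * z + 3 / 2 * gauss_moment 2 p
        = (w ^ 4 - 3 * w ^ 2 + 3 / 4) * z"
      unfolding ii m2 by (simp add: field_simps eval_nat_numeral)
    finally show ?thesis .
  qed
  have m5: "gauss_moment 5 p = \<i> * w * (w ^ 4 - 5 * w ^ 2 + 15 / 4) * z"
  proof -
    have "gauss_moment 5 p = \<i> * w * gauss_moment 4 p + 2 * gauss_moment 3 p"
      using rec[of 4] by simp
    also have "\<dots> = \<i> * w * (w ^ 4 - 5 * w ^ 2 + 15 / 4) * z"
      unfolding m3 m4 by (simp add: field_simps)
    finally show ?thesis .
  qed
  have m6: "gauss_moment 6 p = (- (w ^ 6) + 15 / 2 * w ^ 4 - 45 / 4 * w ^ 2 + 15 / 8) * z"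
  proof -
    have "gauss_moment 6 p = \<i> * w * gauss_moment 5 p + 5 / 2 * gauss_moment 4 p"
      using rec[of 5] by simp
    also have "\<i> * w * gauss_moment 5 p = (\<i> * \<i>) * (w * w) * (w ^ 4 - 5 * w ^ 2 + 15 / 4) * z"
      unfolding m5 by (simp only: mult_ac)
    also have "\<i> * \<i> * (w * w) * (w ^ 4 - 5 * w ^ 2 + 15 / 4) * z + 5 / 2 * gauss_moment 4 p
        = (- (w ^ 6) + 15 / 2 * w ^ 4 - 45 / 4 * w ^ 2 + 15 / 8) * z"
      unfolding ii m4 by (simp add: field_simps eval_nat_numeral)
    finally show ?thesis .
  qed
  show "gauss_moment 2 p = of_real ((1 / 2 - p\<^sup>2) * (sqrt pi * exp (- p\<^sup>2)))"
    "gauss_moment 4 p = of_real ((p ^ 4 - 3 * p\<^sup>2 + 3 / 4) * (sqrt pi * exp (- p\<^sup>2)))"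
    "gauss_moment 6 p = of_real ((- (p ^ 6) + 15 / 2 * p ^ 4 - 45 / 4 * p\<^sup>2 + 15 / 8) * (sqrt pi * exp (- p\<^sup>2)))"
    unfolding m2 m4 m6 by (simp_all add: z_def w_def)
qed

text \<open>The three terms come from |0>, from |3> and from their coherence.
  \<open>F_poly x\<close> is - L_3 (2 * x) with the Laguerre polynomial L_3, the radial profile of
  the third number state.\<close>

definition wigner_psi_poly :: "real \<Rightarrow> real \<Rightarrow> real \<Rightarrow> real" where
  "wigner_psi_poly t q p = 1 + t\<^sup>2 * F_poly (q\<^sup>2 + p\<^sup>2) + 4 * t / sqrt 3 * (q ^ 3 - 3 * q * p\<^sup>2)"

text \<open>The sqrt 2 of \<open>hermite 3\<close> cancels in sqrt (3!) = sqrt 2 * sqrt 3; this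
  leaves the 1 / sqrt 3 seen in all later constants.\<close>

lemma psi_real_eq:
  "psi_real t x = pi powr (- 1 / 4) / sqrt (1 + t\<^sup>2) * (1 + t / sqrt 3 * (2 * x ^ 3 - 3 * x)) * exp (- x\<^sup>2 / 2)"
proof -
  have s: "sqrt 2 * sqrt 2 = 2" by simp
  have h: "hermite 3 x = sqrt 2 * (2 * x ^ 3 - 3 * x)"
  proof -
    have "hermite 3 x = sqrt 2 * x * (sqrt 2 * x * (sqrt 2 * x) - 1) - 2 * (sqrt 2 * x)"
      by (simp add: numeral_3_eq_3)
    also have "sqrt 2 * x * (sqrt 2 * x) = (sqrt 2 * sqrt 2) * (x * x)" by (simp only: mult_ac)
    also have "\<dots> = 2 * (x * x)" unfolding s ..
    finally show ?thesis by (simp add: algebra_simps power3_eq_cube)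
  qed
  have "sqrt (fact 3) = sqrt 2 * sqrt 3"
    by (simp add: fact_numeral real_sqrt_mult[symmetric])
  then have f3: "fock_real 3 x = pi powr (- 1 / 4) * ((2 * x ^ 3 - 3 * x) / sqrt 3) * exp (- x\<^sup>2 / 2)"
    unfolding fock_real_def h by simp
  have f0: "fock_real 0 x = pi powr (- 1 / 4) * exp (- x\<^sup>2 / 2)"
    by (simp add: fock_real_def)
  show ?thesis
    unfolding psi_real_def f3 f0 by (simp add: algebra_simps add_divide_distrib diff_divide_distrib)
qed

definition wigner_real :: "real \<Rightarrow> real \<Rightarrow> real \<Rightarrow> real \<Rightarrow> real" where
  "wigner_real t \<epsilon> q p =
     (1 - \<epsilon>) * (exp (- (q\<^sup>2 + p\<^sup>2)) / (pi * (1 + t\<^sup>2)) * wigner_psi_poly t q p)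
       + \<epsilon> * (exp (- (q\<^sup>2 + p\<^sup>2) / 2) / (2 * pi))"

lemma wigner_rho_state: "wigner (rho_state t \<epsilon>) q p = of_real (wigner_real t \<epsilon> q p)"
proof -
  \<comment> \<open>With \<open>s\<close> in place of t / sqrt 3 the identities below are polynomial
    and within reach of \<open>algebra\<close>.\<close>
  define s where "s = t / sqrt 3"
  have s2: "s\<^sup>2 = t\<^sup>2 / 3" "4 * s = 4 * t / sqrt 3" by (simp_all add: s_def power_divide)
  define N where "N = 1 + t\<^sup>2"
  have N: "N > 0" unfolding N_def by (simp add: add_pos_nonneg)
  define A where "A = (1 - \<epsilon>) * (exp (- q\<^sup>2) / (sqrt pi * N))"
  define B where "B = \<epsilon> * (exp (- q\<^sup>2 / 2) / sqrt (2 * pi))"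
  \<comment> \<open>\<open>c0\<close> to \<open>c6\<close> are the coefficients in y of the product
    of the cubic factors at q - y and q + y. Reversing y swaps the factors, so odd powers are
    absent.\<close>
  define c0 where "c0 = 1 + s * (4 * q ^ 3 - 6 * q) + s\<^sup>2 * (4 * q ^ 6 - 12 * q ^ 4 + 9 * q\<^sup>2)"
  define c2 where "c2 = 12 * s * q - s\<^sup>2 * (12 * q ^ 4 + 9)"
  define c4 where "c4 = s\<^sup>2 * (12 * q\<^sup>2 + 12)"
  define c6 where "c6 = - 4 * s\<^sup>2"
  have psi: "psi_real t (q - y) * psi_real t (q + y)
      = exp (- q\<^sup>2) / (sqrt pi * N) * ((c0 + c2 * y\<^sup>2 + c4 * y ^ 4 + c6 * y ^ 6) * exp (- y\<^sup>2))" for y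
  proof -
    have 1: "pi powr (- 1 / 4) * pi powr (- 1 / 4) = 1 / sqrt pi"
      by (simp add: powr_add[symmetric] powr_minus_divide powr_half_sqrt)
    have 2: "sqrt N * sqrt N = N" using N by simp
    have 3: "exp (- (q - y)\<^sup>2 / 2) * exp (- (q + y)\<^sup>2 / 2) = exp (- q\<^sup>2) * exp (- y\<^sup>2)"
      unfolding exp_add[symmetric] by (rule arg_cong[of _ _ exp]) (simp add: field_simps power2_eq_square)
    have 4: "(1 + s * (2 * (q - y) ^ 3 - 3 * (q - y))) * (1 + s * (2 * (q + y) ^ 3 - 3 * (q + y)))
        = c0 + c2 * y\<^sup>2 + c4 * y ^ 4 + c6 * y ^ 6"
      unfolding c0_def c2_def c4_def c6_def by algebra
    have "psi_real t (q - y) * psi_real t (q + y) = (pi powr (- 1 / 4) * pi powr (- 1 / 4)) / (sqrt N * sqrt N) *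
       ((1 + s * (2 * (q - y) ^ 3 - 3 * (q - y))) * (1 + s * (2 * (q + y) ^ 3 - 3 * (q + y)))) *
       (exp (- (q - y)\<^sup>2 / 2) * exp (- (q + y)\<^sup>2 / 2))"
      unfolding psi_real_eq N_def[symmetric] s_def[symmetric] by (simp only: divide_inverse inverse_mult_distrib mult_ac)
    then show ?thesis unfolding 1 2 3 4 by simp
  qed
  have th: "thermal_kernel (q - y) (q + y) = exp (- q\<^sup>2 / 2) / sqrt (2 * pi) * exp (- 2 * y\<^sup>2)" for y
    unfolding thermal_kernel_def times_divide_eq_left exp_add[symmetric]
    by (simp add: field_simps power2_eq_square)
  let ?e = "\<lambda>y::real. exp (2 * \<i> * of_real p * of_real y)"
  let ?g = "\<lambda>k (y::real). of_real (y ^ k) * (?e y * complex_of_real (exp (- y\<^sup>2)))"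
  let ?h = "\<lambda>y::real. ?e y * complex_of_real (exp (- 2 * y\<^sup>2))"
  have eq: "?e y * position_kernel (rho_state t \<epsilon>) (q - y) (q + y)
     = of_real (A * c0) * ?g 0 y + of_real (A * c2) * ?g 2 y + of_real (A * c4) * ?g 4 y
       + of_real (A * c6) * ?g 6 y + of_real B * ?h y" for y
  proof -
    have "rho_kernel t \<epsilon> (q - y) (q + y) = A * c0 * (y ^ 0 * exp (- y\<^sup>2)) + A * c2 * (y ^ 2 * exp (- y\<^sup>2))
      + A * c4 * (y ^ 4 * exp (- y\<^sup>2)) + A * c6 * (y ^ 6 * exp (- y\<^sup>2)) + B * exp (- 2 * y\<^sup>2)"
      unfolding rho_kernel_def psi th A_def B_def by (simp add: algebra_simps)
    then have "?e y * position_kernel (rho_state t \<epsilon>) (q - y) (q + y) = ?e y * complex_of_real 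
       (A * c0 * (y ^ 0 * exp (- y\<^sup>2)) + A * c2 * (y ^ 2 * exp (- y\<^sup>2))
      + A * c4 * (y ^ 4 * exp (- y\<^sup>2)) + A * c6 * (y ^ 6 * exp (- y\<^sup>2)) + B * exp (- 2 * y\<^sup>2))"
      unfolding position_kernel_rho_state by (simp only:)
    then show ?thesis
      by (simp only: of_real_add of_real_mult distrib_left mult_ac)
  qed
  \<comment> \<open>\<open>has_bochner_integral\<close> carries integrability and value together, so
    the five summands can be added without side conditions.\<close>
  have ig: "has_bochner_integral lborel (\<lambda>y. complex_of_real c * ?g k y) (of_real c * gauss_moment k p)" for c k
    unfolding gauss_moment_def
    by (intro has_bochner_integral_mult_right has_bochner_integral_integrable integrable_gauss_moment)
  have ih: "has_bochner_integral lborel (\<lambda>y. complex_of_real B * ?h y)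
      (of_real B * of_real (sqrt (pi / 2) * exp (- p\<^sup>2 / 2)))"
    unfolding gauss_fourier[OF zero_less_numeral, of p, symmetric]
  proof (intro has_bochner_integral_mult_right has_bochner_integral_integrable, rule Bochner_Integration.integrable_bound)
    show "integrable lborel (\<lambda>y::real. exp (- 2 * y\<^sup>2))"
      by (rule integrable_exp_minus_square) simp
  qed (auto simp: norm_mult)
  have "(LINT y|lborel. ?e y * position_kernel (rho_state t \<epsilon>) (q - y) (q + y))
      = of_real (A * c0) * gauss_moment 0 p + of_real (A * c2) * gauss_moment 2 p + of_real (A * c4) * gauss_moment 4 p
        + of_real (A * c6) * gauss_moment 6 p + of_real B * of_real (sqrt (pi / 2) * exp (- p\<^sup>2 / 2))"
    unfolding eq
    by (intro has_bochner_integral_integral_eq has_bochner_integral_add ig ih)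
  also have "\<dots> = of_real (A * (sqrt pi * exp (- p\<^sup>2)) * (c0 + c2 * (1 / 2 - p\<^sup>2) + c4 * (p ^ 4 - 3 * p\<^sup>2 + 3 / 4)
        + c6 * (- (p ^ 6) + 15 / 2 * p ^ 4 - 45 / 4 * p\<^sup>2 + 15 / 8)) + B * (sqrt (pi / 2) * exp (- p\<^sup>2 / 2)))"
    unfolding gauss_moment_even of_real_mult[symmetric] of_real_add[symmetric]
    by (rule arg_cong[of _ _ of_real]) (simp only: distrib_left distrib_right mult_ac)
  \<comment> \<open>The rotational symmetry of the diagonal part appears only here, once the
    y-moments have supplied the matching powers of p.\<close>
  also have "c0 + c2 * (1 / 2 - p\<^sup>2) + c4 * (p ^ 4 - 3 * p\<^sup>2 + 3 / 4)
        + c6 * (- (p ^ 6) + 15 / 2 * p ^ 4 - 45 / 4 * p\<^sup>2 + 15 / 8) = wigner_psi_poly t q p"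
  proof -
    have "wigner_psi_poly t q p = 1 + 3 * s\<^sup>2 * F_poly (q\<^sup>2 + p\<^sup>2) + 4 * s * (q ^ 3 - 3 * q * p\<^sup>2)"
      unfolding wigner_psi_poly_def s2 by simp
    moreover have "3 * s\<^sup>2 * F_poly x = s\<^sup>2 * (- 3 + 18 * x - 18 * x\<^sup>2 + 4 * x ^ 3)" for x
      by (simp add: F_poly_def algebra_simps)
    moreover have "c0 + c2 * (1 / 2 - p\<^sup>2) + c4 * (p ^ 4 - 3 * p\<^sup>2 + 3 / 4)
        + c6 * (- (p ^ 6) + 15 / 2 * p ^ 4 - 45 / 4 * p\<^sup>2 + 15 / 8)
      = 1 + s\<^sup>2 * (- 3 + 18 * (q\<^sup>2 + p\<^sup>2) - 18 * (q\<^sup>2 + p\<^sup>2)\<^sup>2 + 4 * (q\<^sup>2 + p\<^sup>2) ^ 3)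
        + 4 * s * (q ^ 3 - 3 * q * p\<^sup>2)"
      unfolding c0_def c2_def c4_def c6_def by algebra
    ultimately show ?thesis by simp
  qed
  also have "A * (sqrt pi * exp (- p\<^sup>2)) = (1 - \<epsilon>) * (exp (- (q\<^sup>2 + p\<^sup>2)) / N)"
  proof -
    have "exp (- (q\<^sup>2 + p\<^sup>2)) = exp (- q\<^sup>2) * exp (- p\<^sup>2)" by (simp add: exp_add[symmetric])
    then show ?thesis unfolding A_def by simp
  qed
  also have "B * (sqrt (pi / 2) * exp (- p\<^sup>2 / 2)) = \<epsilon> * (exp (- (q\<^sup>2 + p\<^sup>2) / 2) / 2)"
  proof -
    have "exp (- (q\<^sup>2 + p\<^sup>2) / 2) = exp (- q\<^sup>2 / 2) * exp (- p\<^sup>2 / 2)"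
      unfolding exp_add[symmetric] by (simp add: add_divide_distrib)
    moreover have "sqrt (pi / 2) / sqrt (2 * pi) = 1 / 2"
      by (simp add: real_sqrt_divide real_sqrt_mult)
    moreover have "B * (sqrt (pi / 2) * exp (- p\<^sup>2 / 2))
        = \<epsilon> * (exp (- q\<^sup>2 / 2) * exp (- p\<^sup>2 / 2)) * (sqrt (pi / 2) / sqrt (2 * pi))"
      unfolding B_def by (simp only: divide_inverse mult_ac)
    ultimately show ?thesis by simp
  qed
  finally have I: "(LINT y|lborel. ?e y * position_kernel (rho_state t \<epsilon>) (q - y) (q + y)) =
     of_real ((1 - \<epsilon>) * (exp (- (q\<^sup>2 + p\<^sup>2)) / N) * wigner_psi_poly t q p + \<epsilon> * (exp (- (q\<^sup>2 + p\<^sup>2) / 2) / 2))" .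
  have J: "(1 - \<epsilon>) * (exp (- (q\<^sup>2 + p\<^sup>2)) / (pi * N) * wigner_psi_poly t q p) + \<epsilon> * (exp (- (q\<^sup>2 + p\<^sup>2) / 2) / (2 * pi))
    = 1 / pi * ((1 - \<epsilon>) * (exp (- (q\<^sup>2 + p\<^sup>2)) / N) * wigner_psi_poly t q p + \<epsilon> * (exp (- (q\<^sup>2 + p\<^sup>2) / 2) / 2))"
    by (simp only: divide_inverse inverse_mult_distrib distrib_left mult_1_left mult_ac)
  show ?thesis
    unfolding wigner_real_def wigner_def I N_def[symmetric] J by (simp only: of_real_mult of_real_divide of_real_1)
qed

section \<open>Reduction to a one-variable supremum\<close>

text \<open>The bracket before truncation: at the minimising angle the Wigner function is exact in
  terms of this quantity, while \<open>M_fun\<close> gives a lower bound.\<close>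

definition M_arg :: "real \<Rightarrow> real \<Rightarrow> real" where
  "M_arg t x = - 1 - t\<^sup>2 * F_poly x + 4 * t / sqrt 3 * x powr (3 / 2)"

lemma M_fun_eq: "M_fun t x = 2 * exp (- x / 2) / (1 + t\<^sup>2) * max (M_arg t x) 0"
  by (simp add: M_fun_def M_arg_def)

text \<open>The extremal point has q = - sqrt x, so the cube of the root is how the power arises; in
  this form continuity at 0 is also immediate.\<close>

lemma powr_three_halves:
  assumes "x \<ge> 0"
  shows "x powr (3 / 2) = sqrt x ^ 3"
proof -
  have "sqrt x ^ 3 = (x powr (1 / 2)) powr 3"
    using assms by (simp add: powr_half_sqrt powr_numeral)
  then show ?thesis by (simp add: powr_powr)
qed

lemma powr_three_halves_square:
  fixes x :: real
  assumes "x \<ge> 0"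
  shows "(x powr (3 / 2))\<^sup>2 = x ^ 3"
proof -
  have "(sqrt x ^ 3)\<^sup>2 = ((sqrt x)\<^sup>2) ^ 3" by algebra
  then show ?thesis using assms by (simp add: powr_three_halves)
qed

lemma one_plus_square_pos: "1 + t\<^sup>2 > (0::real)"
  by (simp add: add_pos_nonneg)

text \<open>The cubic form is the real part of \<open>(q + \<i> p)\<^sup>3\<close>, so it is at least \<open>- \<bar>q + \<i> p\<bar>\<^sup>3\<close>.\<close>

lemma minus_wigner_psi_poly_le:
  assumes "t \<ge> 0"
  shows "- wigner_psi_poly t q p \<le> M_arg t (q\<^sup>2 + p\<^sup>2)"
proof -
  define x where "x = q\<^sup>2 + p\<^sup>2"
  have x: "x \<ge> 0" by (simp add: x_def)
  have "\<bar>q ^ 3 - 3 * q * p\<^sup>2\<bar> \<le> \<bar>x powr (3 / 2)\<bar>"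
  proof (rule abs_le_square_iff[THEN iffD2])
    have "(x powr (3 / 2))\<^sup>2 = x ^ 3" by (rule powr_three_halves_square[OF x])
    also have "\<dots> = (q ^ 3 - 3 * q * p\<^sup>2)\<^sup>2 + (3 * q\<^sup>2 * p - p ^ 3)\<^sup>2"
      unfolding x_def by algebra
    finally show "(q ^ 3 - 3 * q * p\<^sup>2)\<^sup>2 \<le> (x powr (3 / 2))\<^sup>2" by simp
  qed
  then have "- (q ^ 3 - 3 * q * p\<^sup>2) \<le> x powr (3 / 2)" by simp
  then have "4 * t / sqrt 3 * - (q ^ 3 - 3 * q * p\<^sup>2) \<le> 4 * t / sqrt 3 * x powr (3 / 2)"
    using assms by (intro mult_left_mono) auto
  then show ?thesis unfolding wigner_psi_poly_def M_arg_def x_def[symmetric] mult_minus_right by linarith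
qed

text \<open>Taking out the thermal Wigner function, which is positive everywhere, leaves an
  expression affine in \<epsilon>. The prefactor 2 * exp (- x / 2) / (1 + t^2) of M is the quotient
  of the pure-state Gaussian by the thermal one.\<close>

lemma wigner_real_factor:
  "wigner_real t \<epsilon> q p = exp (- (q\<^sup>2 + p\<^sup>2) / 2) / (2 * pi) *
     (\<epsilon> - (1 - \<epsilon>) * (2 * exp (- (q\<^sup>2 + p\<^sup>2) / 2) / (1 + t\<^sup>2) * (- wigner_psi_poly t q p)))"
proof -
  have "(1 - \<epsilon>) * (E * E / (pi * N) * P) + \<epsilon> * (E / (2 * pi))
      = E / (2 * pi) * (\<epsilon> - (1 - \<epsilon>) * (2 * E / N * (- P)))" for E N P :: real
    by (cases "N = 0") (simp_all add: field_simps)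
  moreover have "exp (- (q\<^sup>2 + p\<^sup>2)) = exp (- (q\<^sup>2 + p\<^sup>2) / 2) * exp (- (q\<^sup>2 + p\<^sup>2) / 2)"
    unfolding exp_add[symmetric] by simp
  ultimately show ?thesis
    unfolding wigner_real_def by (simp only:)
qed

lemma wigner_real_ge:
  assumes "t \<ge> 0" "\<epsilon> \<le> 1"
  shows "exp (- (q\<^sup>2 + p\<^sup>2) / 2) / (2 * pi) * (\<epsilon> - (1 - \<epsilon>) * M_fun t (q\<^sup>2 + p\<^sup>2)) \<le> wigner_real t \<epsilon> q p"
  unfolding wigner_real_factor M_fun_eq
  using minus_wigner_psi_poly_le[OF assms(1), of q p] assms(2) one_plus_square_pos[of t]
  by (intro mult_left_mono diff_left_mono) auto

text \<open>On the negative q axis (q + \<i> p)^3 equals - x^(3/2), so the bound on the cubic form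
  is attained.\<close>

lemma wigner_real_extremal:
  assumes "x \<ge> 0"
  shows "wigner_real t \<epsilon> (- sqrt x) 0 = exp (- x / 2) / (2 * pi) *
     (\<epsilon> - (1 - \<epsilon>) * (2 * exp (- x / 2) / (1 + t\<^sup>2) * M_arg t x))"
proof -
  have "- wigner_psi_poly t (- sqrt x) 0 = M_arg t x"
    using assms by (simp add: wigner_psi_poly_def M_arg_def powr_three_halves)
  then show ?thesis unfolding wigner_real_factor using assms by simp
qed

text \<open>The square is exact because the leading term 4/3 * t^2 * x^3 is the square of 2 * t /
  sqrt 3 * x^(3/2), which is half the cross term.\<close>

lemma M_arg_complete_square:
  assumes "x \<ge> 0"
  shows "M_arg t x = t\<^sup>2 * (1 - 6 * x + 6 * x\<^sup>2) - (1 - 2 * t / sqrt 3 * x powr (3 / 2))\<^sup>2"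
proof -
  define s where "s = t / sqrt 3"
  have t: "t\<^sup>2 = 3 * s\<^sup>2" by (simp add: s_def power_divide)
  have "(1 - 2 * s * x powr (3 / 2))\<^sup>2 = 1 - 4 * s * x powr (3 / 2) + 4 * s\<^sup>2 * x ^ 3"
    by (simp add: power2_diff power_mult_distrib powr_three_halves_square[OF assms])
  moreover have "M_arg t x = - 1 - 3 * s\<^sup>2 * F_poly x + 4 * s * x powr (3 / 2)"
    unfolding M_arg_def t by (simp add: s_def)
  moreover have "1 - 2 * t / sqrt 3 * x powr (3 / 2) = 1 - 2 * s * x powr (3 / 2)"
    by (simp add: s_def)
  ultimately show ?thesis unfolding t by (simp add: F_poly_def algebra_simps)
qed

section \<open>Boundedness and tail of the function under the supremum\<close>

lemma M_fun_nonneg: "0 \<le> M_fun t x"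
  using one_plus_square_pos[of t] by (simp add: M_fun_eq)

lemma M_fun_le:
  assumes "x \<ge> 0"
  shows "M_fun t x \<le> 2 * t\<^sup>2 * (1 + 6 * x\<^sup>2) * exp (- x / 2)"
proof -
  have "t\<^sup>2 * (1 - 6 * x + 6 * x\<^sup>2) \<le> t\<^sup>2 * (1 + 6 * x\<^sup>2)"
    using assms by (intro mult_left_mono) auto
  then have "M_arg t x \<le> t\<^sup>2 * (1 + 6 * x\<^sup>2)"
    unfolding M_arg_complete_square[OF assms]
    using zero_le_power2[of "1 - 2 * t / sqrt 3 * x powr (3 / 2)"] by linarith
  then have "max (M_arg t x) 0 \<le> t\<^sup>2 * (1 + 6 * x\<^sup>2)" by simp
  moreover have "2 * exp (- x / 2) / (1 + t\<^sup>2) \<le> 2 * exp (- x / 2)"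
    using one_plus_square_pos[of t] by (simp add: divide_le_eq)
  ultimately have "M_fun t x \<le> 2 * exp (- x / 2) * (t\<^sup>2 * (1 + 6 * x\<^sup>2))"
    unfolding M_fun_eq by (intro mult_mono) auto
  then show ?thesis by (simp add: mult_ac)
qed

text \<open>A tail bound from y on, used at 0 for boundedness, at a large R for attainment and at
  the edge of the support for the asymptotics. With s = x - y, x^2 \<le> 2 * y^2 + 2 * s^2 and s^2
  \<le> 8 * exp (s / 2), so the growth is paid for by the decay from y to x; 97 is 1 + 12 *
  8.\<close>

lemma M_fun_le_from:
  assumes "0 \<le> y" "y \<le> x"
  shows "M_fun t x \<le> 2 * t\<^sup>2 * (97 + 12 * y\<^sup>2) * exp (- y / 2)"
proof -
  define s where "s = x - y"
  have s: "s \<ge> 0" using assms by (simp add: s_def)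
  have "1 + s / 2 + (s / 2)\<^sup>2 / 2 \<le> exp (s / 2)"
    by (rule exp_lower_Taylor_quadratic) (use s in simp)
  then have e: "1 \<le> exp (s / 2)" "s\<^sup>2 \<le> 8 * exp (s / 2)"
    using s by (simp_all add: power_divide)
  have "6 * x\<^sup>2 \<le> 12 * y\<^sup>2 + 12 * s\<^sup>2"
  proof -
    have "0 \<le> 6 * (y - s)\<^sup>2" by simp
    then show ?thesis unfolding s_def by (simp add: power2_eq_square algebra_simps)
  qed
  then have "1 + 6 * x\<^sup>2 \<le> (1 + 12 * y\<^sup>2) * 1 + 12 * s\<^sup>2" by simp
  also have "\<dots> \<le> (1 + 12 * y\<^sup>2) * exp (s / 2) + 12 * (8 * exp (s / 2))"
    by (intro add_mono mult_left_mono e) auto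
  also have "\<dots> = (97 + 12 * y\<^sup>2) * exp (s / 2)" by (simp add: algebra_simps)
  finally have "2 * t\<^sup>2 * exp (- x / 2) * (1 + 6 * x\<^sup>2) \<le> 2 * t\<^sup>2 * exp (- x / 2) * ((97 + 12 * y\<^sup>2) * exp (s / 2))"
    by (intro mult_left_mono) auto
  also have "\<dots> = 2 * t\<^sup>2 * (97 + 12 * y\<^sup>2) * (exp (- x / 2) * exp (s / 2))" by (simp only: mult_ac)
  also have "exp (- x / 2) * exp (s / 2) = exp (- y / 2)"
    unfolding exp_add[symmetric] by (simp add: s_def field_simps)
  finally show ?thesis using M_fun_le[of x t] assms by (simp add: mult_ac)
qed

lemma bdd_above_M_fun: "bdd_above (M_fun t ` {0..})"
proof (rule bdd_aboveI2)
  show "M_fun t x \<le> 2 * t\<^sup>2 * (97 + 12 * 0\<^sup>2) * exp (- 0 / 2)" if "x \<in> {0..}" for x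
    using that by (intro M_fun_le_from) auto
qed

lemma M_fun_le_M_sup: "x \<ge> 0 \<Longrightarrow> M_fun t x \<le> M_sup t"
  unfolding M_sup_def by (intro cSUP_upper bdd_above_M_fun) auto

lemma M_sup_nonneg: "0 \<le> M_sup t"
  using M_fun_nonneg[of t 0] M_fun_le_M_sup[of 0 t] by simp

section \<open>The positivity threshold and its zero\<close>

lemma ratio_le_iff:
  assumes "m \<ge> (0::real)"
  shows "m / (1 + m) \<le> \<epsilon> \<longleftrightarrow> (1 - \<epsilon>) * m \<le> \<epsilon>" "m / (1 + m) < \<epsilon> \<longleftrightarrow> (1 - \<epsilon>) * m < \<epsilon>"
  using assms by (simp_all add: divide_le_eq divide_less_eq algebra_simps)

lemma wigner_pos:
  assumes "t > 0" "\<epsilon> \<le> 1" "(1 - \<epsilon>) * M_sup t < \<epsilon>"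
  shows "0 < wigner_real t \<epsilon> q p"
proof -
  have "(1 - \<epsilon>) * M_fun t (q\<^sup>2 + p\<^sup>2) \<le> (1 - \<epsilon>) * M_sup t"
    using assms by (intro mult_left_mono M_fun_le_M_sup) auto
  then have "0 < exp (- (q\<^sup>2 + p\<^sup>2) / 2) / (2 * pi) * (\<epsilon> - (1 - \<epsilon>) * M_fun t (q\<^sup>2 + p\<^sup>2))"
    using assms by (intro mult_pos_pos) auto
  then show ?thesis using wigner_real_ge[of t \<epsilon> q p] assms by simp
qed

text \<open>Testing on the negative q axis already forces the condition: where the bracket is
  negative, \<open>M_fun\<close> is 0 and the inequality reduces to 0 \<le> \<epsilon>.\<close>

lemma wigner_nonneg_at_iff:
  assumes t: "t > 0"
  shows "wigner_nonneg_at t \<epsilon> \<longleftrightarrow> 0 \<le> \<epsilon> \<and> \<epsilon> \<le> 1 \<and> M_sup t / (1 + M_sup t) \<le> \<epsilon>"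
proof (cases "0 \<le> \<epsilon> \<and> \<epsilon> \<le> 1")
  case False
  then show ?thesis by (auto simp: wigner_nonneg_at_def)
next
  case True
  have "(\<forall>q p. 0 \<le> wigner_real t \<epsilon> q p) \<longleftrightarrow> (1 - \<epsilon>) * M_sup t \<le> \<epsilon>"
  proof
    assume nn: "\<forall>q p. 0 \<le> wigner_real t \<epsilon> q p"
    have le: "(1 - \<epsilon>) * M_fun t x \<le> \<epsilon>" if x: "x \<ge> 0" for x
    proof (cases "M_arg t x \<ge> 0")
      case True
      then have "0 \<le> exp (- x / 2) / (2 * pi) * (\<epsilon> - (1 - \<epsilon>) * M_fun t x)"
        using nn[rule_format, of "- sqrt x" 0] unfolding wigner_real_extremal[OF x] M_fun_eq by (simp add: max_absorb1)
      moreover have "exp (- x / 2) / (2 * pi) > 0" by simp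
      ultimately have "0 \<le> \<epsilon> - (1 - \<epsilon>) * M_fun t x" by (metis zero_le_mult_iff less_le_not_le)
      then show ?thesis by simp
    next
      case False
      then show ?thesis using True by (simp add: M_fun_eq)
    qed
    show "(1 - \<epsilon>) * M_sup t \<le> \<epsilon>"
    \<comment> \<open>The supremum is bounded by \<epsilon> / (1 - \<epsilon>), which excludes the
      endpoint.\<close>
    proof (cases "\<epsilon> = 1")
      case False
      then have e: "\<epsilon> < 1" using True by simp
      have "M_sup t \<le> \<epsilon> / (1 - \<epsilon>)"
        unfolding M_sup_def using le e by (intro cSUP_least) (auto simp: field_simps)
      then show ?thesis using e by (simp add: field_simps)
    qed simp
  next
    assume le: "(1 - \<epsilon>) * M_sup t \<le> \<epsilon>"
    show "\<forall>q p. 0 \<le> wigner_real t \<epsilon> q p"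
    proof (intro allI)
      fix q p
      have "(1 - \<epsilon>) * M_fun t (q\<^sup>2 + p\<^sup>2) \<le> (1 - \<epsilon>) * M_sup t"
        using True by (intro mult_left_mono M_fun_le_M_sup) auto
      then have "0 \<le> exp (- (q\<^sup>2 + p\<^sup>2) / 2) / (2 * pi) * (\<epsilon> - (1 - \<epsilon>) * M_fun t (q\<^sup>2 + p\<^sup>2))"
        using le by (intro mult_nonneg_nonneg) auto
      then show "0 \<le> wigner_real t \<epsilon> q p" using wigner_real_ge[of t \<epsilon> q p] t True by simp
    qed
  qed
  then show ?thesis
    using True ratio_le_iff(1)[OF M_sup_nonneg, of t \<epsilon>]
    by (simp add: wigner_nonneg_at_def wigner_rho_state less_eq_complex_def)
qed

lemma wigner_nonneg_at_ratio:
  assumes "t > 0"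
  shows "wigner_nonneg_at t (M_sup t / (1 + M_sup t))"
  using M_sup_nonneg[of t] by (simp add: wigner_nonneg_at_iff[OF assms])

lemma eps_star_eq:
  assumes "t > 0"
  shows "eps_star t = M_sup t / (1 + M_sup t)"
  unfolding eps_star_def
  by (rule Least_equality) (use wigner_nonneg_at_ratio[OF assms] wigner_nonneg_at_iff[OF assms] in auto)

text \<open>A maximiser is what yields an actual zero of the Wigner function. A positive value at
  some \<open>x1\<close> exceeds the tail bound beyond a suitable R, and compactness of
  \<open>{0..R}\<close> does the rest.\<close>

lemma M_sup_attained:
  assumes "M_sup t > 0"
  shows "\<exists>x\<ge>0. M_fun t x = M_sup t"
proof -
  obtain x1 where x1: "x1 \<ge> 0" "M_fun t x1 > 0"
  proof -
    have "\<exists>x\<in>{0..}. M_fun t x > 0"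
      using assms less_cSUP_iff[OF _ bdd_above_M_fun, of 0 t] unfolding M_sup_def by auto
    then show ?thesis using that by auto
  qed
  have "((\<lambda>x. 2 * t\<^sup>2 * (97 + 12 * x\<^sup>2) * exp (- x / 2)) \<longlongrightarrow> 0) at_top" by real_asymp
  then have "\<forall>\<^sub>F x in at_top. 2 * t\<^sup>2 * (97 + 12 * x\<^sup>2) * exp (- x / 2) < M_fun t x1"
    using x1 by (intro order_tendstoD)
  then have "\<forall>\<^sub>F x in at_top. 2 * t\<^sup>2 * (97 + 12 * x\<^sup>2) * exp (- x / 2) < M_fun t x1 \<and> x \<ge> x1"
    using eventually_ge_at_top by (rule eventually_conj)
  then obtain R where R: "2 * t\<^sup>2 * (97 + 12 * R\<^sup>2) * exp (- R / 2) < M_fun t x1" "R \<ge> x1"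
    by (metis (no_types, lifting) eventually_at_top_linorder order_refl)
  have "continuous_on {0..R} (\<lambda>x. 2 * exp (- x / 2) / (1 + t\<^sup>2) *
      max (- 1 - t\<^sup>2 * F_poly x + 4 * t / sqrt 3 * sqrt x ^ 3) 0)"
    unfolding F_poly_def using one_plus_square_pos[of t] by (intro continuous_intros) auto
  then have "continuous_on {0..R} (M_fun t)"
    by (rule continuous_on_eq) (simp add: M_fun_def powr_three_halves)
  then obtain x where x: "x \<in> {0..R}" "\<And>y. y \<in> {0..R} \<Longrightarrow> M_fun t y \<le> M_fun t x"
    using continuous_attains_sup[of "{0..R}" "M_fun t"] x1 R by auto
  have "M_fun t y \<le> M_fun t x" if "y \<ge> 0" for y
  proof (cases "y \<le> R")
    case False
    then have "M_fun t y \<le> 2 * t\<^sup>2 * (97 + 12 * R\<^sup>2) * exp (- R / 2)"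
      using x1 R by (intro M_fun_le_from) auto
    also have "\<dots> \<le> M_fun t x1" using R by simp
    also have "\<dots> \<le> M_fun t x" using x1 R by (intro x) auto
    finally show ?thesis .
  qed (use that x in auto)
  then have "M_sup t \<le> M_fun t x" unfolding M_sup_def by (intro cSUP_least) auto
  then show ?thesis using M_fun_le_M_sup[of x t] x by (intro exI[of _ x]) auto
qed

text \<open>At a maximiser the bracket is positive, so truncation changes nothing and the bound is
  an equality on the negative q axis.\<close>

lemma wigner_zero_at_eps_star:
  assumes "t > 0" "M_sup t > 0"
  shows "\<exists>q p. wigner_real t (eps_star t) q p = 0"
proof -
  obtain x where x: "x \<ge> 0" "M_fun t x = M_sup t" using M_sup_attained assms by blast
  then have pos: "M_arg t x > 0"
    using assms unfolding M_fun_eq by (cases "M_arg t x > 0") (auto simp: max_def split: if_splits)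
  have "eps_star t - (1 - eps_star t) * M_sup t = 0"
    using assms unfolding eps_star_eq[OF assms(1)] by (simp add: field_simps)
  then have "wigner_real t (eps_star t) (- sqrt x) 0 = 0"
    using pos x unfolding wigner_real_extremal[OF x(1)] M_fun_eq by (simp add: max_absorb1)
  then show ?thesis by blast
qed

section \<open>Asymptotics\<close>

text \<open>The zero of the square in \<open>M_arg_complete_square\<close>.\<close>

definition peak :: "real \<Rightarrow> real" where
  "peak t = (3 / 4) powr (1 / 3) * t powr (- 2 / 3)"

lemma peak_pos: "t > 0 \<Longrightarrow> peak t > 0"
  by (simp add: peak_def)

lemma peak_powr:
  assumes "t > 0"
  shows "2 * t / sqrt 3 * peak t powr (3 / 2) = 1"
proof -
  have "peak t powr (3 / 2) = (3 / 4) powr (1 / 2) * t powr (- 1)"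
    using assms by (simp add: peak_def powr_mult powr_powr)
  also have "\<dots> = sqrt 3 / 2 / t"
    using assms by (simp add: powr_half_sqrt real_sqrt_divide powr_minus_divide)
  finally show ?thesis using assms by simp
qed

text \<open>At the peak only t^2 * (1 - 6 * x + 6 * x^2) survives, which is at least t^2 for x \<ge>
  1; the factor 2 compensates 1 + t^2.\<close>

lemma M_sup_lower:
  assumes "0 < t" "t \<le> 1" "peak t \<ge> 1"
  shows "t\<^sup>2 * exp (- peak t / 2) \<le> M_sup t"
proof -
  have "1 \<le> 1 - 6 * peak t + 6 * (peak t)\<^sup>2"
    using assms(3) by (simp add: power2_eq_square)
  then have "t\<^sup>2 * 1 \<le> t\<^sup>2 * (1 - 6 * peak t + 6 * (peak t)\<^sup>2)"
    by (intro mult_left_mono) auto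
  also have "\<dots> = M_arg t (peak t)"
    using M_arg_complete_square[of "peak t" t] assms unfolding peak_powr[OF assms(1)] by simp
  finally have arg: "t\<^sup>2 \<le> max (M_arg t (peak t)) 0" by simp
  have "t\<^sup>2 \<le> 1" using assms by (simp add: power_le_one)
  then have "exp (- peak t / 2) \<le> 2 * exp (- peak t / 2) / (1 + t\<^sup>2)"
    using one_plus_square_pos[of t] by (simp add: le_divide_eq)
  then have "exp (- peak t / 2) * t\<^sup>2 \<le> 2 * exp (- peak t / 2) / (1 + t\<^sup>2) * max (M_arg t (peak t)) 0"
    using arg by (intro mult_mono) auto
  also have "\<dots> = M_fun t (peak t)" by (simp add: M_fun_eq)
  also have "\<dots> \<le> M_sup t" using assms by (intro M_fun_le_M_sup) auto
  finally show ?thesis by (simp add: mult.commute)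
qed

text \<open>In the unit u = x / peak the square is (1 - u^(3/2))^2. A positive bracket bounds its
  root by t * (1 + 3 * x), because 1 - 6 * x + 6 * x^2 \<le> (1 + 3 * x)^2 for x \<ge> 0.\<close>

lemma M_fun_support:
  assumes "t > 0" "x \<ge> 0" "M_fun t x > 0"
  shows "peak t - t * peak t * (1 + 3 * peak t) \<le> x"
proof (cases "x \<le> peak t")
  case False
  then show ?thesis using assms peak_pos[of t]
    by (smt (verit) mult_nonneg_nonneg)
next
  case True
  have x0: "peak t > 0" by (rule peak_pos[OF assms(1)])
  define u where "u = x / peak t"
  have u: "0 \<le> u" "u \<le> 1" using True x0 assms by (auto simp: u_def)
  have xu: "2 * t / sqrt 3 * x powr (3 / 2) = u powr (3 / 2)"
  proof -
    have "x powr (3 / 2) = u powr (3 / 2) * peak t powr (3 / 2)"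
      using u x0 by (simp add: powr_mult[symmetric]) (simp add: u_def)
    then have "2 * t / sqrt 3 * x powr (3 / 2) = u powr (3 / 2) * (2 * t / sqrt 3 * peak t powr (3 / 2))"
      by (simp only: mult_ac)
    then show ?thesis unfolding peak_powr[OF assms(1)] by simp
  qed
  have "M_arg t x > 0"
    using assms(3) unfolding M_fun_eq by (cases "M_arg t x > 0") (auto simp: max_def split: if_splits)
  then have "(1 - u powr (3 / 2))\<^sup>2 < t\<^sup>2 * (1 - 6 * x + 6 * x\<^sup>2)"
    unfolding M_arg_complete_square[OF assms(2)] xu by simp
  also have "\<dots> \<le> t\<^sup>2 * (1 + 3 * x)\<^sup>2"
    using assms by (intro mult_left_mono) (auto simp: power2_eq_square algebra_simps)
  finally have "(1 - u powr (3 / 2))\<^sup>2 \<le> (t * (1 + 3 * x))\<^sup>2" by (simp add: power_mult_distrib)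
  then have "1 - u powr (3 / 2) \<le> t * (1 + 3 * x)"
    by (rule power2_le_imp_le) (use assms in auto)
  also have "\<dots> \<le> t * (1 + 3 * peak t)"
    using True assms by (intro mult_left_mono) auto
  finally have "1 - u powr (3 / 2) \<le> t * (1 + 3 * peak t)" .
  \<comment> \<open>On [0, 1] this makes the bound linear in u.\<close>
  moreover have "u powr (3 / 2) \<le> u"
    using powr_mono'[of 1 "3 / 2" u] u by simp
  ultimately have "1 - u \<le> t * (1 + 3 * peak t)" by simp
  then have "peak t * (1 - u) \<le> peak t * (t * (1 + 3 * peak t))"
    using x0 by (intro mult_left_mono) auto
  moreover have "peak t * (1 - u) = peak t - x" using x0 by (simp add: u_def field_simps)
  ultimately show ?thesis by (simp add: mult_ac)
qed

text \<open>Left of y the function vanishes, right of y the tail bound applies. The last hypothesis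
  absorbs its polynomial prefactor and holds for small t, since t^2 * peak^2 is of order
  t^(2/3).\<close>

lemma M_sup_upper:
  fixes t :: real
  defines "y \<equiv> peak t - t * peak t * (1 + 3 * peak t)"
  assumes "0 < t" "0 \<le> y" "2 * t\<^sup>2 * (97 + 12 * (peak t)\<^sup>2) \<le> 1"
  shows "M_sup t \<le> exp (- y / 2)"
  unfolding M_sup_def
proof (intro cSUP_least)
  fix x :: real
  assume x: "x \<in> {0..}"
  show "M_fun t x \<le> exp (- y / 2)"
  proof (cases "M_fun t x > 0")
    case True
    have x0: "peak t > 0" by (rule peak_pos[OF assms(2)])
    have yx: "y \<le> x" using M_fun_support[OF assms(2) _ True] x by (simp add: y_def)
    have "y \<le> peak t" using assms(2) x0 by (simp add: y_def)
    then have "y\<^sup>2 \<le> (peak t)\<^sup>2" using assms(3) by (intro power_mono)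
    then have "2 * t\<^sup>2 * (97 + 12 * y\<^sup>2) \<le> 2 * t\<^sup>2 * (97 + 12 * (peak t)\<^sup>2)"
      by (intro mult_left_mono) auto
    also note assms(4)
    finally have "2 * t\<^sup>2 * (97 + 12 * y\<^sup>2) * exp (- y / 2) \<le> 1 * exp (- y / 2)"
      by (intro mult_right_mono) auto
    then show ?thesis using M_fun_le_from[OF assms(3) yx, of t] by linarith
  next
    case False
    then show ?thesis using exp_gt_zero[of "- y / 2"] by linarith
  qed
qed auto

lemma eventually_peak_bounds:
  "\<forall>\<^sub>F t in at_right 0. 0 < t \<and> t \<le> 1 \<and> peak t \<ge> 1 \<and>
     0 \<le> peak t - t * peak t * (1 + 3 * peak t) \<and> 2 * t\<^sup>2 * (97 + 12 * (peak t)\<^sup>2) \<le> 1"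
proof -
  \<comment> \<open>An abstract positive \<open>c\<close> lets \<open>real_asymp\<close> treat the
    constant as a parameter.\<close>
  define c :: real where "c = (3 / 4) powr (1 / 3)"
  have c: "c > 0" by (simp add: c_def)
  have "\<forall>\<^sub>F t in at_right 0. 0 < (t::real)" by (simp add: eventually_at_right_less)
  moreover have "\<forall>\<^sub>F t in at_right 0. (t::real) \<le> 1" by real_asymp
  moreover have "\<forall>\<^sub>F t in at_right 0. c * t powr (- 2 / 3) \<ge> 1" using c by real_asymp
  moreover have "\<forall>\<^sub>F t in at_right 0. 0 \<le> c * t powr (- 2 / 3) -
      t * (c * t powr (- 2 / 3)) * (1 + 3 * (c * t powr (- 2 / 3)))" using c by real_asymp
  moreover have "\<forall>\<^sub>F t in at_right 0. 2 * t\<^sup>2 * (97 + 12 * (c * t powr (- 2 / 3))\<^sup>2) \<le> 1" using c by real_asymp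
  ultimately show ?thesis unfolding peak_def c_def[symmetric] by eventually_elim simp
qed

lemma tendsto_ln_eps_star:
  "((\<lambda>t. t powr (2 / 3) * ln (eps_star t)) \<longlongrightarrow> - (1 / 2) * (3 / 4) powr (1 / 3)) (at_right 0)"
proof (rule tendsto_sandwich)
  define c :: real where "c = (3 / 4) powr (1 / 3)"
  have c: "c > 0" by (simp add: c_def)
  \<comment> \<open>The logarithm here, and the shift of order t * peak^2 in the other bound, are of
    lower order than t^(-2/3), so both limits are - c / 2.\<close>
  show "((\<lambda>t. t powr (2 / 3) * (ln (t\<^sup>2 / 2) - peak t / 2)) \<longlongrightarrow> - (1 / 2) * (3 / 4) powr (1 / 3)) (at_right 0)"
    unfolding peak_def c_def[symmetric] using c by real_asymp
  show "((\<lambda>t. t powr (2 / 3) * (- (peak t - t * peak t * (1 + 3 * peak t)) / 2)) \<longlongrightarrow> - (1 / 2) * (3 / 4) powr (1 / 3)) (at_right 0)"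
    unfolding peak_def c_def[symmetric] using c by real_asymp
  have "\<forall>\<^sub>F t in at_right 0.
      t powr (2 / 3) * (ln (t\<^sup>2 / 2) - peak t / 2) \<le> t powr (2 / 3) * ln (eps_star t) \<and>
      t powr (2 / 3) * ln (eps_star t) \<le> t powr (2 / 3) * (- (peak t - t * peak t * (1 + 3 * peak t)) / 2)"
    using eventually_peak_bounds
  proof eventually_elim
    case (elim t)
    define y where "y = peak t - t * peak t * (1 + 3 * peak t)"
    have lo: "t\<^sup>2 * exp (- peak t / 2) \<le> M_sup t" using M_sup_lower elim by blast
    have up: "M_sup t \<le> exp (- y / 2)" using M_sup_upper elim unfolding y_def by blast
    have "t\<^sup>2 * exp (- peak t / 2) > 0" using elim by simp
    then have pos: "M_sup t > 0" using lo by linarith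
    have "exp (- y / 2) \<le> 1" using elim by (simp add: y_def)
    then have M1: "M_sup t \<le> 1" using up by linarith
    \<comment> \<open>As 0 < M \<le> 1, the denominator 1 + M lies between 1 and 2; the lower bound
      accounts for the 2 in ln (t^2 / 2).\<close>
    have eps: "M_sup t / 2 \<le> eps_star t" "eps_star t \<le> M_sup t"
      using pos M1 elim unfolding eps_star_eq[OF conjunct1[OF elim]]
      by (auto simp: divide_le_eq le_divide_eq intro: frac_le)
    have "ln (t\<^sup>2 / 2) - peak t / 2 = ln (t\<^sup>2 / 2 * exp (- peak t / 2))"
      using elim by (subst ln_mult) auto
    also have "\<dots> \<le> ln (eps_star t)"
    proof (rule ln_mono)
      show "t\<^sup>2 / 2 * exp (- peak t / 2) \<le> eps_star t" using eps lo by simp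
    qed (use elim eps pos in auto)
    finally have 1: "ln (t\<^sup>2 / 2) - peak t / 2 \<le> ln (eps_star t)" .
    have "ln (eps_star t) \<le> ln (exp (- y / 2))"
      using eps up pos by (intro ln_mono) auto
    then have 2: "ln (eps_star t) \<le> - y / 2" by simp
    show ?case
      using mult_left_mono[OF 1, of "t powr (2 / 3)"] mult_left_mono[OF 2, of "t powr (2 / 3)"]
      by (simp add: y_def)
  qed
  then show "\<forall>\<^sub>F t in at_right 0. t powr (2 / 3) * (ln (t\<^sup>2 / 2) - peak t / 2) \<le> t powr (2 / 3) * ln (eps_star t)"
    and "\<forall>\<^sub>F t in at_right 0. t powr (2 / 3) * ln (eps_star t) \<le> t powr (2 / 3) * (- (peak t - t * peak t * (1 + 3 * peak t)) / 2)"
    by (auto elim: eventually_mono)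
qed

text \<open>\<open>LEAST\<close> and \<open>SUP\<close> return a value even without a least element
  or an upper bound. The minimality conjunct and \<open>bdd_above\<close> certify that
  \<open>eps_star\<close> and \<open>M_sup\<close> are a true minimum and a true supremum.\<close>

theorem proposition3:
  shows "(\<forall>t>0. wigner_nonneg_at t (eps_star t) \<and>
                (\<forall>\<epsilon>. wigner_nonneg_at t \<epsilon> \<longrightarrow> eps_star t \<le> \<epsilon>)) \<and>
         (\<forall>\<^sub>F t in at_right 0.
            bdd_above (M_fun t ` {0..}) \<and>
            eps_star t = M_sup t / (1 + M_sup t) \<and>
            (\<exists>q p. wigner (rho_state t (eps_star t)) q p = 0) \<and>
            (\<forall>\<epsilon>. eps_star t < \<epsilon> \<and> \<epsilon> \<le> 1 \<longrightarrow> (\<forall>q p. 0 < wigner (rho_state t \<epsilon>) q p))) \<and>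
         ((\<lambda>t. t powr (2 / 3) * ln (eps_star t)) \<longlongrightarrow> - (1 / 2) * (3 / 4) powr (1 / 3)) (at_right 0)"
proof (intro conjI tendsto_ln_eps_star allI impI)
  fix t :: real
  assume t: "t > 0"
  show "wigner_nonneg_at t (eps_star t)"
    using wigner_nonneg_at_ratio[OF t] by (simp add: eps_star_eq[OF t])
  show "eps_star t \<le> \<epsilon>" if "wigner_nonneg_at t \<epsilon>" for \<epsilon>
    using that by (simp add: eps_star_eq[OF t] wigner_nonneg_at_iff[OF t])
next
  show "\<forall>\<^sub>F t in at_right 0.
            bdd_above (M_fun t ` {0..}) \<and>
            eps_star t = M_sup t / (1 + M_sup t) \<and>
            (\<exists>q p. wigner (rho_state t (eps_star t)) q p = 0) \<and>
            (\<forall>\<epsilon>. eps_star t < \<epsilon> \<and> \<epsilon> \<le> 1 \<longrightarrow> (\<forall>q p. 0 < wigner (rho_state t \<epsilon>) q p))"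
    using eventually_peak_bounds
  proof eventually_elim
    case (elim t)
    then have t: "t > 0" by simp
    have "0 < t\<^sup>2 * exp (- peak t / 2)" using t by simp
    also have "\<dots> \<le> M_sup t" using M_sup_lower elim by blast
    finally have pos: "M_sup t > 0" .
    have "0 < wigner (rho_state t \<epsilon>) q p" if "eps_star t < \<epsilon>" "\<epsilon> \<le> 1" for \<epsilon> q p
    proof -
      have "(1 - \<epsilon>) * M_sup t < \<epsilon>"
        using that ratio_le_iff(2)[OF M_sup_nonneg] by (simp add: eps_star_eq[OF t])
      then have "0 < wigner_real t \<epsilon> q p" using t that by (intro wigner_pos)
      then show ?thesis by (simp add: wigner_rho_state less_complex_def)
    qed
    then show ?case
      using bdd_above_M_fun eps_star_eq[OF t] wigner_zero_at_eps_star[OF t pos]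
      by (simp add: wigner_rho_state)
  qed
qed

end
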